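(* Let $n\ge 3$ be a fixed integer. There is a constant $C_n>0$ depending only on $n$ (in particular independent of the $a_i$, of $m$, $l$, $A$, $B$, $M$, and of $T$ and $R$ below) such that the following holds. Let $m\ge 1$ be an integer, $l\in\mathbb{Z}/m\mathbb{Z}$, let $M>1$, $A\ge 2$, $B>0$ be real numbers, and let $a_0,a_1,\dots,a_{n-2}\in\mathbb{Z}$ be such that every prime $p$ dividing $\gcd(a_0,a_1)$ satisfies $p<M$ or $p\mid m$. Put $$T=\log\max\big(\{|a_i|:0\le i\le n-2\}\cup\{A\}\big),\qquad R=\min\Big(\frac{A}{m},\frac{B}{m^2}\Big),$$ and assume $\log R+\log T>0$. For integers $s,t$ write $$f=f_{s,t}=a_0X^n+a_1X^{n-1}Y+\cdots+a_{n-2}X^2Y^{n-2}+sXY^{n-1}+tY^n .$$ Then the number of pairs $(s,t)\in\mathbb{Z}^2$ with $|s|\le A$ and $|t|\le B$ such that $m^2\mid f(l,1)$, $m\mid \frac{\partial f}{\partial X}(l,1)$, and there exists a prime $p>M$ with $p\nmid m$ and $$p\mid\gcd\big(\mathrm{Ksh}(a_0,a_1,\dots,a_{n-2},s),\ \mathrm{disc}(a_0,a_1,\dots,a_{n-2},s,t)\big)$$ is at most $$C_n\left(\frac{T}{R(\log R+\log T)}+\frac{1}{M\log M}+\frac{m}{A}+\frac{m^3}{AB}\right)\cdot\frac{AB}{m^3}.$$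
   Context: For $d\ge 1$ the universal discriminant $\mathrm{disc}(c_0,\dots,c_d)\in\mathbb{Z}[c_0,\dots,c_d]$ is the discriminant of the degree-$d$ form $c_0X^d+c_1X^{d-1}Y+\cdots+c_dY^d$, equivalently of the polynomial $c_0X^d+\cdots+c_d$ of formal degree $d$; it is normalized by $\mathrm{disc}=c_0^{2d-2}\prod_{i<j}(\delta_i-\delta_j)^2$ if the form equals $c_0\prod_{i=1}^d(X-\delta_iY)$. The polynomial $\mathrm{Ksh}\in\mathbb{Z}[X_0,\dots,X_{n-1}]$ is $$\mathrm{Ksh}(X_0,\dots,X_{n-1})=\mathrm{disc}_{X_n}\big(\mathrm{disc}_X(X_0X^n+X_1X^{n-1}+\cdots+X_n)\big),$$ where the inner discriminant is regarded as a polynomial in $X_n$ of degree $n-1$ over $\mathbb{Z}[X_0,\dots,X_{n-1}]$ and the outer discriminant is that of a polynomial of (formal) degree $n-1$. The pair of conditions $m^2\mid f(l,1)$ and $m\mid\frac{\partial f}{\partial X}(l,1)$ is independent of the integer representative chosen for $l$. *)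

theory Defs
  imports Complex_Main "Subresultants.Resultant_Prelim"
begin

text \<open>Bivariate polynomials are polynomials in \<open>X\<close> with coefficients in \<open>R[Y]\<close>, so that
  \<^const>\<open>pderiv\<close> is the partial derivative with respect to \<open>X\<close>.
  \<open>binary_form d c\<close> is \<open>c\<^sub>0 X^d + c\<^sub>1 X^(d-1) Y + \<dots> + c\<^sub>d Y^d\<close>; values of \<open>c\<close> beyond
  \<open>d\<close> are irrelevant (here and in \<open>disc\<close>, \<open>Ksh\<close> below).\<close>

definition binary_form :: "nat \<Rightarrow> (nat \<Rightarrow> 'a::idom) \<Rightarrow> 'a poly poly" where
  "binary_form d c = (\<Sum>i\<le>d. monom (monom (c i) i) (d - i))"

definition eval_XY :: "'a::idom poly poly \<Rightarrow> 'a \<Rightarrow> 'a \<Rightarrow> 'a" where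
  "eval_XY f x y = poly (poly f [:x:]) y"

definition dehom_form :: "nat \<Rightarrow> (nat \<Rightarrow> 'a::idom) \<Rightarrow> 'a poly" where
  "dehom_form d c = (\<Sum>i\<le>d. monom (c i) (d - i))"

text \<open>The discriminant of formal degree \<open>d\<close> is given by a division-free formula, valid also when
  leading coefficients vanish. For the dehomogenized form \<open>F\<close>, the first column of the
  \<open>(2d-1) \<times> (2d-1)\<close> Sylvester matrix of \<open>F\<close> and \<open>F'\<close> has as its only nonzero entries \<open>c\<^sub>0\<close> (top row,
  if \<open>d > 1\<close>) and \<open>d c\<^sub>0\<close> (top row of the \<open>F'\<close> block). In \<open>disc_mat\<close> this column is divided by \<open>c\<^sub>0\<close>.
  The determinant is a fixed integer polynomial in \<open>c\<^sub>0, \<dots>, c\<^sub>d\<close>: it commutes with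
  ring homomorphisms (\<open>hom_disc\<close>). It satisfies \<open>c\<^sub>0 disc(F) = (-1)^(d(d-1)/2) Res(F, F')\<close>
  (\<open>disc_resultant\<close>) and is normalized by \<open>disc = c\<^sub>0^(2d-2) \<Prod>\<^sub>i\<^sub><\<^sub>j (\<delta>\<^sub>i - \<delta>\<^sub>j)^2\<close> for the form
  \<open>c\<^sub>0 \<Prod> (X - \<delta>\<^sub>i Y)\<close> (\<open>disc_roots\<close>).\<close>

definition disc_mat :: "nat \<Rightarrow> (nat \<Rightarrow> 'a::idom) \<Rightarrow> 'a mat" where
  "disc_mat d c = mat (2 * d - 1) (2 * d - 1) (\<lambda>(i, j).
     if j = 0 then (if i = d - 1 then of_nat d else if i = 0 then 1 else 0)
     else sylvester_mat_sub d (d - 1) (dehom_form d c) (pderiv (dehom_form d c)) $$ (i, j))"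

definition disc :: "nat \<Rightarrow> (nat \<Rightarrow> 'a::idom) \<Rightarrow> 'a" where
  "disc d c = (-1) ^ (d choose 2) * det (disc_mat d c)"

text \<open>\<open>Ksh n x\<close> is the value of \<open>Ksh\<close> at \<open>(x\<^sub>0, \<dots>, x\<^sub>n\<^sub>-\<^sub>1)\<close>. The inner discriminant is that of
  \<open>x\<^sub>0 X^n + \<dots> + x\<^sub>n\<^sub>-\<^sub>1 X + X\<^sub>n\<close> with the indeterminate \<open>X\<^sub>n = [:0, 1:]\<close>; it has degree at most
  \<open>n - 1\<close> in \<open>X\<^sub>n\<close> (\<open>degree_disc_last\<close>). Taking for \<open>x\<close> the indeterminates of a polynomial ring
  gives the polynomial \<open>Ksh\<close> itself, and evaluation is compatible with this by \<open>hom_Ksh\<close>.\<close>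

definition Ksh :: "nat \<Rightarrow> (nat \<Rightarrow> 'a::idom) \<Rightarrow> 'a" where
  "Ksh n x = disc (n - 1) (\<lambda>i. coeff (disc n (\<lambda>j. if j < n then [:x j:] else [:0, 1:])) (n - 1 - i))"

lemma coeff_dehom_form: "coeff (dehom_form d c) k = (if k \<le> d then c (d - k) else 0)"
proof -
  have "coeff (dehom_form d c) k = (\<Sum>i\<le>d. if d - i = k then c i else 0)"
    by (simp add: dehom_form_def coeff_sum)
  also have "\<dots> = (\<Sum>i\<in>{..d}. if i = d - k \<and> k \<le> d then c i else 0)"
    by (rule sum.cong) auto
  also have "\<dots> = (if k \<le> d then c (d - k) else 0)"
    by (cases "k \<le> d") (simp_all add: sum.delta)
  finally show ?thesis .
qed

lemma disc_mat_carrier: "disc_mat d c \<in> carrier_mat (2 * d - 1) (2 * d - 1)"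
  unfolding disc_mat_def by (rule mat_carrier)

lemma disc_resultant:
  fixes c :: "nat \<Rightarrow> 'a::idom"
  assumes "d \<ge> 1"
  shows "c 0 * disc d c = (-1) ^ (d choose 2) *
    resultant_sub d (d - 1) (dehom_form d c) (pderiv (dehom_form d c))"
proof -
  define F where "F = dehom_form d c"
  define S where "S = sylvester_mat_sub d (d - 1) F (pderiv F)"
  define N where "N = 2 * d - 1"
  have N: "d + (d - 1) = N" "N > 0" using assms by (auto simp: N_def)
  have S: "S \<in> carrier_mat N N" unfolding S_def using N sylvester_mat_sub_carrier[of d "d - 1"] by simp
  have D: "disc_mat d c \<in> carrier_mat N N" unfolding N_def by (rule disc_mat_carrier)
  have coeffs: "coeff F d = c 0" "coeff (pderiv F) (d - 1) = of_nat d * c 0"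
    using assms by (auto simp: F_def coeff_dehom_form coeff_pderiv Suc_diff_le)
  have "transpose_mat S = multrow 0 (c 0) (transpose_mat (disc_mat d c))"
  proof (rule eq_matI, goal_cases)
    case (1 i j)
    hence ij: "i < N" "j < N" using D by auto
    have "S $$ (j, i) = (if i = 0 then c 0 * disc_mat d c $$ (j, i) else disc_mat d c $$ (j, i))"
    proof (cases "i = 0")
      case True
      have "S $$ (j, 0) = (if j = d - 1 then of_nat d * c 0 else if j = 0 then c 0 else 0)"
        unfolding S_def using ij True N coeffs assms
        by (subst sylvester_mat_sub_index) auto
      thus ?thesis using True ij N by (auto simp: disc_mat_def N_def mult.commute)
    next
      case False
      thus ?thesis using ij N by (simp add: disc_mat_def S_def F_def N_def)
    qed
    thus ?case using ij S D by (auto simp: mat_multrow_def)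
  qed (use S D in auto)
  hence "det (transpose_mat S) = c 0 * det (transpose_mat (disc_mat d c))"
    using det_multrow[OF N(2), of "transpose_mat (disc_mat d c)" "c 0"] D by simp
  hence "det S = c 0 * det (disc_mat d c)"
    by (simp add: det_transpose[OF S] det_transpose[OF D])
  thus ?thesis
    by (simp add: disc_def resultant_sub_def S_def F_def algebra_simps)
qed

context idom_hom
begin

lemma hom_disc: "hom (disc d c) = disc d (\<lambda>i. hom (c i))"
proof -
  have F: "map_poly hom (dehom_form d c) = dehom_form d (\<lambda>i. hom (c i))"
    by (rule poly_eqI) (simp add: coeff_map_poly coeff_dehom_form)
  have F': "map_poly hom (pderiv p) = pderiv (map_poly hom p)" for p
    by (rule poly_eqI) (simp add: coeff_map_poly coeff_pderiv hom_distribs)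
  have "map_mat hom (disc_mat d c) = disc_mat d (\<lambda>i. hom (c i))"
  proof (rule eq_matI, goal_cases)
    case (1 i j)
    hence ij: "i < 2 * d - 1" "j < 2 * d - 1" by (auto simp: disc_mat_def)
    hence "i < d + (d - 1)" "j < d + (d - 1)" by auto
    hence "hom (sylvester_mat_sub d (d - 1) (dehom_form d c) (pderiv (dehom_form d c)) $$ (i, j))
      = sylvester_mat_sub d (d - 1) (dehom_form d (\<lambda>i. hom (c i))) (pderiv (dehom_form d (\<lambda>i. hom (c i)))) $$ (i, j)"
      by (simp add: sylvester_mat_sub_index flip: F F')
    thus ?case using ij by (simp add: disc_mat_def hom_distribs)
  qed (auto simp: disc_mat_def)
  thus ?thesis by (simp add: disc_def hom_distribs flip: hom_det)
qed

end

lemma disc_cong: "(\<And>i. i \<le> d \<Longrightarrow> c i = c' i) \<Longrightarrow> disc d c = disc d c'"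
proof -
  assume "\<And>i. i \<le> d \<Longrightarrow> c i = c' i"
  hence "dehom_form d c = dehom_form d c'" by (simp add: dehom_form_def)
  thus ?thesis by (simp only: disc_def disc_mat_def)
qed

lemma (in idom_hom) hom_Ksh: "hom (Ksh n x) = Ksh n (\<lambda>i. hom (x i))"
proof -
  interpret P: map_poly_idom_hom hom ..
  show ?thesis
    unfolding Ksh_def hom_disc
    by (subst coeff_map_poly_hom[symmetric], subst P.hom_disc, rule disc_cong,
        intro arg_cong2[where f = coeff] disc_cong) (auto simp: hom_distribs)
qed

lemma degree_disc_last:
  fixes x :: "nat \<Rightarrow> 'a::idom"
  assumes "n \<ge> 1"
  shows "degree (disc n (\<lambda>j. if j < n then [:x j:] else [:0, 1:])) \<le> n - 1"
proof -
  define c where "c = (\<lambda>j. if j < n then [:x j:] else [:0, 1::'a:])"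
  define N where "N = 2 * n - 1"
  define b where "b = (\<lambda>i. if i < n - 1 then 1 else 0::nat)"
  have deg_c: "degree (c k) \<le> 1" for k by (simp add: c_def)
  have deg_c0: "degree (c k) = 0" if "k < n" for k using that by (simp add: c_def)
  have entry: "degree (disc_mat n c $$ (i, j)) \<le> b i" if ij: "i < N" "j < N" for i j
  proof -
    have "\<exists>a. coeff (pderiv (dehom_form n c)) k = [:a:]" for k
    proof (cases "Suc k \<le> n")
      case True
      hence "coeff (pderiv (dehom_form n c)) k = [:of_nat (Suc k) * x (n - Suc k):]"
        by (simp add: coeff_pderiv coeff_dehom_form c_def of_nat_poly del: of_nat_Suc)
      thus ?thesis by blast
    next
      case False
      hence "coeff (pderiv (dehom_form n c)) k = [:0:]"
        by (simp add: coeff_pderiv coeff_dehom_form)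
      thus ?thesis by blast
    qed
    hence *: "degree (coeff (pderiv (dehom_form n c)) k) = 0" for k
      by (metis degree_pCons_0)
    have **: "degree (coeff (dehom_form n c) k) \<le> 1" for k
      using deg_c[of "n - k"] by (simp add: coeff_dehom_form)
    have "i < n + (n - 1)" "j < n + (n - 1)" using ij by (auto simp: N_def)
    hence "degree (sylvester_mat_sub n (n - 1) (dehom_form n c) (pderiv (dehom_form n c)) $$ (i, j)) \<le> b i"
      using * ** by (auto simp: sylvester_mat_sub_index b_def simp del: One_nat_def)
    thus ?thesis using ij by (auto simp: disc_mat_def N_def simp del: One_nat_def)
  qed
  have D: "disc_mat n c \<in> carrier_mat N N" unfolding N_def by (rule disc_mat_carrier)
  have b: "sum b {0..<N} = n - 1"
  proof -
    have "{0..<N} \<inter> {i. i < n - 1} = {0..<n - 1}" by (auto simp: N_def)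
    thus ?thesis by (simp add: b_def sum.If_cases)
  qed
  have "degree (det (disc_mat n c)) \<le> n - 1"
    unfolding det_def'[OF D]
  proof (rule degree_sum_le)
    show "finite {p. p permutes {0..<N}}" by (simp add: finite_permutations)
    fix p assume "p \<in> {p. p permutes {0..<N}}"
    hence p: "p i < N" if "i < N" for i using that permutes_in_image[of p "{0..<N}" i] by auto
    have "degree (\<Prod>i = 0..<N. disc_mat n c $$ (i, p i)) \<le> (\<Sum>i = 0..<N. degree (disc_mat n c $$ (i, p i)))"
      by (rule degree_prod_sum_le[unfolded o_def]) simp
    also have "\<dots> \<le> sum b {0..<N}"
      by (rule sum_mono) (use p entry in auto)
    finally show "degree (signof p * (\<Prod>i = 0..<N. disc_mat n c $$ (i, p i))) \<le> n - 1"
      using b by (auto simp: sign_def)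
  qed
  hence "degree (disc n c) \<le> n - 1"
    by (cases "even (n choose 2)") (simp_all add: disc_def)
  thus ?thesis by (simp add: c_def)
qed


lemma sum_bidiagonal:
  fixes f :: "nat \<Rightarrow> 'a::comm_ring_1"
  assumes "i < n"
  shows "(\<Sum>k = 0..<n. (if k = i then 1 else if k = Suc i \<and> P then y else 0) * f k)
    = f i + (if P \<and> Suc i < n then y * f (Suc i) else 0)"
proof -
  have "(\<Sum>k = 0..<n. (if k = i then 1 else if k = Suc i \<and> P then y else 0) * f k)
    = (\<Sum>k = 0..<n. (if k = i then f k else 0) + (if k = Suc i then (if P then y * f k else 0) else 0))"
    by (rule sum.cong) auto
  also have "\<dots> = f i + (if P \<and> Suc i < n then y * f (Suc i) else 0)"
    using assms by (simp add: sum.distrib)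
  finally show ?thesis .
qed

lemma sylvester_mat_sub_coeff:
  fixes p q :: "'a::idom poly"
  assumes "degree p \<le> m" "degree q \<le> e" "i < m + e" "j < m + e"
  shows "sylvester_mat_sub m e p q $$ (i, j) =
    coeff (if i < e then monom 1 (e - 1 - i) * p else monom 1 (m + e - 1 - i) * q) (m + e - 1 - j)"
proof (cases "i < e")
  case True
  have "m + e - 1 - j - (e - 1 - i) = m + i - j" if "e - 1 - i \<le> m + e - 1 - j"
    using True that assms by auto
  moreover have "coeff p (m + i - j) = 0" if "\<not> i \<le> j"
    using assms that by (intro coeff_eq_0) auto
  ultimately show ?thesis
    using True assms by (auto simp: sylvester_mat_sub_index coeff_monom_mult)
next
  case False
  have "m + e - 1 - j - (m + e - 1 - i) = i - j" if "j \<le> i"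
    using False that assms by auto
  moreover have "coeff q (i - j) = 0" if "\<not> i - e \<le> j"
    using assms that by (intro coeff_eq_0) auto
  ultimately show ?thesis
    using False assms by (auto simp: sylvester_mat_sub_index coeff_monom_mult)
qed

lemma resultant_sub_linear_factor:
  fixes h q :: "'a::idom poly"
  assumes h: "degree h \<le> m" and q: "degree q \<le> e"
  shows "resultant_sub (Suc m) e ([:- \<delta>, 1:] * h) q = poly q \<delta> * resultant_sub m e h q"
proof -
  define N where "N = m + e"
  define p where "p = [:- \<delta>, 1:] * h"
  have p: "degree p \<le> Suc m"
    unfolding p_def by (rule order_trans[OF degree_mult_le]) (use h in simp)
  define S where "S = sylvester_mat_sub m e h q"
  define S' where "S' = sylvester_mat_sub (Suc m) e p q"
  define K where "K = mat (Suc N) (Suc N)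
    (\<lambda>(i, j). if j = i then 1 else if j = Suc i \<and> e \<le> i then - \<delta> else 0)"
  define B where "B = mat (Suc N) (Suc N)
    (\<lambda>(i, j). if i < N then (if j = i then 1 else if j = Suc i \<and> True then - \<delta> else 0) else coeff q (N - j))"
  define U where "U = mat (Suc N) (Suc N) (\<lambda>(i, j). if i \<le> j then \<delta> ^ (j - i) else 0)"
  define S1 where "S1 = four_block_mat S (0\<^sub>m N 1) (0\<^sub>m 1 N) (1\<^sub>m 1)"
  have S: "S \<in> carrier_mat N N" unfolding S_def N_def by (rule sylvester_mat_sub_carrier)
  have S': "S' \<in> carrier_mat (Suc N) (Suc N)" using sylvester_mat_sub_carrier[of "Suc m" e p q] by (simp add: S'_def N_def)
  have K: "K \<in> carrier_mat (Suc N) (Suc N)" by (simp add: K_def)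
  have B: "B \<in> carrier_mat (Suc N) (Suc N)" by (simp add: B_def)
  have U: "U \<in> carrier_mat (Suc N) (Suc N)" by (simp add: U_def)
  have S1: "S1 \<in> carrier_mat (Suc N) (Suc N)" 
    unfolding S1_def by (rule carrier_matI) (use S in simp_all)
  have mult: "(X * Y) $$ (i, j) = (\<Sum>k = 0..<Suc N. X $$ (i, k) * Y $$ (k, j))"
    if "X \<in> carrier_mat (Suc N) (Suc N)" "Y \<in> carrier_mat (Suc N) (Suc N)" "i < Suc N" "j < Suc N"
    for X Y :: "'a mat" and i j
    using that by (simp add: scalar_prod_def del: sum.op_ivl_Suc)

  define P where "P = (\<lambda>i. if i < e then monom 1 (e - 1 - i) * h else monom 1 (N - 1 - i) * q)"
  define P' where "P' = (\<lambda>i. if i < e then monom 1 (e - 1 - i) * p else monom 1 (N - i) * q)"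
  have S_coeff: "S $$ (i, j) = coeff (P i) (N - 1 - j)" if "i < N" "j < N" for i j
    using sylvester_mat_sub_coeff[OF h q, of i j] that by (simp add: S_def P_def N_def)
  have S'_coeff: "S' $$ (i, j) = coeff (P' i) (N - j)" if "i < Suc N" "j < Suc N" for i j
    using sylvester_mat_sub_coeff[OF p q, of i j] that by (simp add: S'_def P'_def N_def)
  have deg_P: "degree (P i) < N" if "i < N" for i
  proof -
    have "degree (monom 1 k * r) \<le> k + degree r" for k and r :: "'a poly"
      using degree_mult_le[of "monom 1 k" r] degree_monom_le[of "1::'a" k] by linarith
    from this[of "e - 1 - i" h] this[of "N - 1 - i" q] show ?thesis
      using that h q by (auto simp: P_def N_def)
  qed
  have step: "(if e \<le> i then P' i - smult \<delta> (P' (Suc i)) else P' i) = [:- \<delta>, 1:] * P i" if "i < N" for i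
  proof (cases "e \<le> i")
    case True
    have "monom 1 (N - i) = monom 1 1 * monom (1::'a) (N - 1 - i)"
      using that by (simp add: mult_monom Suc_diff_Suc)
    thus ?thesis using True that
      by (simp add: P_def P'_def monom_Suc algebra_simps monom_0)
  next
    case False
    thus ?thesis by (simp add: P_def P'_def p_def algebra_simps)
  qed

  have "K * S' = S1 * B"
  proof (rule eq_matI, goal_cases)
    case (1 i j)
    hence ij: "i < Suc N" "j < Suc N" using S1 B by auto
    have "(K * S') $$ (i, j) = (\<Sum>k = 0..<Suc N. (if k = i then 1 else if k = Suc i \<and> e \<le> i then - \<delta> else 0) * S' $$ (k, j))"
      unfolding mult[OF K S' ij] by (rule sum.cong) (use ij in \<open>auto simp: K_def\<close>)
    also have "\<dots> = S' $$ (i, j) + (if e \<le> i \<and> Suc i < Suc N then - \<delta> * S' $$ (Suc i, j) else 0)"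
      by (rule sum_bidiagonal) (use ij in auto)
    finally have L: "(K * S') $$ (i, j) = S' $$ (i, j) + (if e \<le> i \<and> Suc i < Suc N then - \<delta> * S' $$ (Suc i, j) else 0)" .
    show ?case
    proof (cases "i < N")
      case True
      have "(S1 * B) $$ (i, j) = (\<Sum>k = 0..<N. S $$ (i, k) * B $$ (k, j))"
        unfolding mult[OF S1 B ij] using S True by (simp add: S1_def)
      also have "\<dots> = (\<Sum>k = 0..<N. (if k = j then S $$ (i, k) else 0) + (if j > 0 \<and> k = j - 1 then - \<delta> * S $$ (i, k) else 0))"
        by (rule sum.cong) (use ij in \<open>auto simp: B_def\<close>)
      also have "\<dots> = (if j < N then S $$ (i, j) else 0) + (if j > 0 then - \<delta> * S $$ (i, j - 1) else 0)"
        using ij by (cases j) (simp_all add: sum.distrib)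
      also have "\<dots> = coeff ([:- \<delta>, 1:] * P i) (N - j)"
      proof -
        have "(if j < N then S $$ (i, j) else 0) = coeff (pCons 0 (P i)) (N - j)"
        proof (cases "j < N")
          case j: True
          hence "N - j = Suc (N - 1 - j)" by simp
          thus ?thesis using True j S_coeff[of i j] by simp
        qed (use ij in simp)
        moreover have "(if j > 0 then S $$ (i, j - 1) else 0) = coeff (P i) (N - j)"
          using True ij S_coeff[of i "j - 1"] coeff_eq_0[OF deg_P[OF True]] by (cases j) auto
        ultimately show ?thesis by (auto split: if_splits)
      qed
      also have "\<dots> = coeff (if e \<le> i then P' i - smult \<delta> (P' (Suc i)) else P' i) (N - j)"
        using step[OF True] by simp
      also have "\<dots> = (K * S') $$ (i, j)"
        unfolding L using True ij S'_coeff[of i j] S'_coeff[of "Suc i" j] by simp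
      finally show ?thesis ..
    next
      case False
      hence [simp]: "i = N" using ij by simp
      have "(S1 * B) $$ (i, j) = B $$ (N, j)"
        unfolding mult[OF S1 B ij] using S by (simp add: S1_def)
      moreover have "(K * S') $$ (i, j) = S' $$ (N, j)" unfolding L by simp
      ultimately show ?thesis using ij S'_coeff[of N j] by (simp add: B_def P'_def N_def)
    qed
  qed (use K S' S1 B in auto)
  hence "det K * det S' = det S1 * det B"
    using det_mult[OF K S'] det_mult[OF S1 B] by simp
  moreover have "det K = 1"
  proof -
    have "upper_triangular K" by (auto simp: upper_triangular_def K_def)
    hence "det K = prod_list (diag_mat K)" using det_upper_triangular K by blast
    thus ?thesis using K by (simp add: prod_list_diag_prod K_def)
  qed
  moreover have "det S1 = det S"
    unfolding S1_def
    using det_four_block_mat_upper_right_zero_col[OF S refl zero_carrier_mat one_carrier_mat] by simp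
  moreover have "det U = 1"
  proof -
    have "upper_triangular U" by (auto simp: upper_triangular_def U_def)
    hence "det U = prod_list (diag_mat U)" using det_upper_triangular U by blast
    thus ?thesis using U by (simp add: prod_list_diag_prod U_def)
  qed
  moreover have "det (B * U) = poly q \<delta>"
  proof -
    have BU: "B * U \<in> carrier_mat (Suc N) (Suc N)" using B U by simp
    have entry: "(B * U) $$ (i, j) = (if i = j then 1 else 0)" if ij: "i < N" "j < Suc N" for i j
    proof -
      have "(B * U) $$ (i, j) = (\<Sum>k = 0..<Suc N. (if k = i then 1 else if k = Suc i \<and> True then - \<delta> else 0) * U $$ (k, j))"
        by (subst mult[OF B U], use ij in simp, use ij in simp, rule sum.cong)
          (use ij in \<open>auto simp: B_def\<close>)
      also have "\<dots> = U $$ (i, j) + (if True \<and> Suc i < Suc N then - \<delta> * U $$ (Suc i, j) else 0)"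
        by (rule sum_bidiagonal) (use ij in auto)
      also have "\<dots> = (if i = j then 1 else 0)"
      proof (cases "Suc i \<le> j")
        case True
        hence "j - i = Suc (j - Suc i)" by simp
        thus ?thesis using True ij by (simp add: U_def)
      qed (use ij in \<open>auto simp: U_def\<close>)
      finally show ?thesis .
    qed
    have last: "(B * U) $$ (N, N) = poly q \<delta>"
    proof -
      have "(B * U) $$ (N, N) = (\<Sum>k = 0..<Suc N. coeff q (N - k) * \<delta> ^ (N - k))"
        unfolding mult[OF B U lessI lessI]
        by (rule sum.cong) (auto simp: B_def U_def)
      also have "\<dots> = (\<Sum>k\<le>N. coeff q k * \<delta> ^ k)"
        by (rule sum.reindex_bij_witness[of _ "\<lambda>k. N - k" "\<lambda>k. N - k"]) auto
      also have "\<dots> = poly q \<delta>"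
        using q by (subst poly_as_sum_of_monoms'[of q N, symmetric])
          (auto simp: N_def poly_sum poly_monom)
      finally show ?thesis .
    qed
    have "det (B * U) = prod_list (diag_mat (B * U))"
      by (rule det_lower_triangular[OF _ BU]) (use entry in simp)
    also have "\<dots> = (\<Prod>i = 0..<Suc N. (B * U) $$ (i, i))"
      using BU by (simp only: prod_list_diag_prod carrier_matD)
    also have "\<dots> = poly q \<delta>"
      using last entry by simp
    finally show ?thesis .
  qed
  ultimately have "det S' = det S * poly q \<delta>"
    using det_mult[OF B U] by simp
  thus ?thesis by (simp add: resultant_sub_def S_def S'_def p_def mult.commute)
qed

lemma resultant_sub_roots:
  fixes q :: "'a::idom poly"
  assumes "degree q \<le> e"
  shows "resultant_sub d e (smult a (\<Prod>i<d. [:- \<delta> i, 1:])) q = a ^ e * (\<Prod>i<d. poly q (\<delta> i))"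
proof (induction d)
  case 0
  have "sylvester_mat_sub 0 e [:a:] q = a \<cdot>\<^sub>m 1\<^sub>m e"
    by (rule eq_matI) (auto simp: sylvester_mat_sub_index)
  thus ?case by (simp add: resultant_sub_def)
next
  case (Suc d)
  have "degree (smult a (\<Prod>i<d. [:- \<delta> i, 1:])) \<le> d"
    using degree_prod_sum_le[of "{..<d}" "\<lambda>i. [:- \<delta> i, 1:]"] by (simp add: o_def)
  from resultant_sub_linear_factor[OF this assms, of "\<delta> d"]
  show ?case by (simp add: Suc.IH mult_ac)
qed

lemma poly_pderiv_root_prod:
  fixes \<delta> :: "nat \<Rightarrow> 'a::idom"
  assumes "k < d"
  shows "poly (pderiv (\<Prod>i<d. [:- \<delta> i, 1:])) (\<delta> k) = (\<Prod>i\<in>{..<d} - {k}. \<delta> k - \<delta> i)"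
proof -
  have "(\<Prod>i<d. [:- \<delta> i, 1:]) = [:- \<delta> k, 1:] * (\<Prod>i\<in>{..<d} - {k}. [:- \<delta> i, 1:])"
    using assms by (subst prod.remove[of _ k]) auto
  thus ?thesis by (simp add: pderiv_mult pderiv_pCons poly_prod del: mult_pCons_left)
qed

lemma prod_differences:
  fixes \<delta> :: "nat \<Rightarrow> 'a::idom"
  shows "(\<Prod>k<d. \<Prod>i\<in>{..<d} - {k}. \<delta> k - \<delta> i)
    = (-1) ^ (d choose 2) * (\<Prod>j<d. \<Prod>i<j. (\<delta> i - \<delta> j)\<^sup>2)"
proof (induction d)
  case (Suc d)
  have "{..<Suc d} - {d} = {..<d}" by auto
  moreover have "(\<Prod>i\<in>{..<Suc d} - {k}. \<delta> k - \<delta> i) = (\<delta> k - \<delta> d) * (\<Prod>i\<in>{..<d} - {k}. \<delta> k - \<delta> i)"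
    if "k < d" for k
  proof -
    have "{..<Suc d} - {k} = insert d ({..<d} - {k})" using that by auto
    thus ?thesis by simp
  qed
  ultimately have "(\<Prod>k<Suc d. \<Prod>i\<in>{..<Suc d} - {k}. \<delta> k - \<delta> i)
    = (\<Prod>k<d. \<delta> k - \<delta> d) * (\<Prod>k<d. \<Prod>i\<in>{..<d} - {k}. \<delta> k - \<delta> i) * (\<Prod>i<d. \<delta> d - \<delta> i)"
    by (simp add: prod.distrib)
  also have "(\<Prod>i<d. \<delta> d - \<delta> i) = (-1) ^ d * (\<Prod>i<d. \<delta> i - \<delta> d)"
  proof -
    have "\<delta> d - \<delta> i = (-1) * (\<delta> i - \<delta> d)" for i by simp
    hence "(\<Prod>i<d. \<delta> d - \<delta> i) = (\<Prod>i<d. (-1) * (\<delta> i - \<delta> d))" by presburger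
    thus ?thesis by (simp only: prod.distrib prod_constant card_lessThan)
  qed
  finally have L: "(\<Prod>k<Suc d. \<Prod>i\<in>{..<Suc d} - {k}. \<delta> k - \<delta> i)
    = (\<Prod>i<d. \<delta> i - \<delta> d) * ((-1) ^ (d choose 2) * (\<Prod>j<d. \<Prod>i<j. (\<delta> i - \<delta> j)\<^sup>2))
      * ((-1) ^ d * (\<Prod>i<d. \<delta> i - \<delta> d))"
    by (simp only: Suc.IH)
  have ch: "Suc d choose 2 = d + (d choose 2)" by (simp add: numeral_2_eq_2)
  show ?case
    unfolding L ch power_add prod.lessThan_Suc[of _ d] prod_power_distrib
    by (simp only: power2_eq_square prod.distrib mult_ac)
qed (simp add: numeral_2_eq_2)

lemma disc_dehom_roots:
  fixes c \<delta> :: "nat \<Rightarrow> 'a::idom"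
  assumes d: "d \<ge> 1" and c0: "c 0 \<noteq> 0"
    and form: "dehom_form d c = smult (c 0) (\<Prod>i<d. [:- \<delta> i, 1:])"
  shows "disc d c = c 0 ^ (2 * d - 2) * (\<Prod>j<d. \<Prod>i<j. (\<delta> i - \<delta> j)\<^sup>2)"
proof -
  define G where "G = (\<Prod>i<d. [:- \<delta> i, 1:])"
  have "degree (pderiv (smult (c 0) G)) \<le> d - 1"
    unfolding G_def form[symmetric]
    by (intro degree_le) (auto simp: coeff_pderiv coeff_dehom_form)
  hence "resultant_sub d (d - 1) (smult (c 0) G) (pderiv (smult (c 0) G))
    = c 0 ^ (d - 1) * (\<Prod>k<d. c 0 * (\<Prod>i\<in>{..<d} - {k}. \<delta> k - \<delta> i))"
    unfolding G_def by (subst resultant_sub_roots) (simp_all add: pderiv_smult poly_pderiv_root_prod)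
  also have "\<dots> = c 0 ^ (d - 1 + d) * ((-1) ^ (d choose 2) * (\<Prod>j<d. \<Prod>i<j. (\<delta> i - \<delta> j)\<^sup>2))"
    by (simp add: prod.distrib prod_differences power_add)
  finally have "c 0 * disc d c = c 0 ^ (d - 1 + d) * (\<Prod>j<d. \<Prod>i<j. (\<delta> i - \<delta> j)\<^sup>2)"
    using disc_resultant[OF d, of c] form by (simp add: G_def flip: power_add mult_2)
  also have "d - 1 + d = Suc (2 * d - 2)" using d by simp
  finally show ?thesis using c0 by simp
qed

lemma dehom_form_eq: "dehom_form d c = map_poly (\<lambda>q. poly q 1) (binary_form d c)"
proof -
  interpret H: map_poly_idom_hom "\<lambda>q. poly q (1::'a)" ..
  show ?thesis
    by (simp add: dehom_form_def binary_form_def H.hom_sum poly_monom)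
qed

theorem disc_roots:
  fixes c \<delta> :: "nat \<Rightarrow> 'a::idom"
  assumes "d \<ge> 1" and "c 0 \<noteq> 0"
    and "binary_form d c = smult [:c 0:] (\<Prod>i<d. [:- monom (\<delta> i) 1, 1:])"
  shows "disc d c = c 0 ^ (2 * d - 2) * (\<Prod>j<d. \<Prod>i<j. (\<delta> i - \<delta> j)\<^sup>2)"
proof (rule disc_dehom_roots)
  interpret H: map_poly_idom_hom "\<lambda>q. poly q (1::'a)" ..
  show "dehom_form d c = smult (c 0) (\<Prod>i<d. [:- \<delta> i, 1:])"
    unfolding dehom_form_eq assms(3)
    by (simp add: H.hom_prod poly_hom.map_poly_hom_smult poly_monom)
qed (use assms in auto)

end

theory Submission
  imports Defs
begin

text \<open>Write \<open>K(s)\<close> and \<open>D(s, t)\<close> for the two integers whose gcd is considered. Giving \<open>a\<^sub>i\<close> the weight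
  \<open>i\<close> makes the discriminant and \<open>Ksh\<close> isobaric, so the leading coefficients of \<open>D(s, \<cdot>)\<close> and of \<open>K\<close>
  are a nonzero constant depending on \<open>n\<close> times a power of \<open>a\<^sub>0\<close>; if \<open>p\<close> divides \<open>a\<^sub>0\<close> but not \<open>a\<^sub>1\<close>,
  then modulo \<open>p\<close> the situation is the one for degree \<open>n - 1\<close>. Hence, for large \<open>p\<close> not dividing
  \<open>gcd(a\<^sub>0, a\<^sub>1)\<close>, boundedly many \<open>s\<close> modulo \<open>p\<close> are zeros of \<open>K\<close>, and for each \<open>s\<close> boundedly many
  \<open>t\<close> modulo \<open>p\<close> are zeros of \<open>D(s, \<cdot>)\<close>. The primes in \<open>(M, R]\<close> contribute
  \<open>O(AB/(m\<^sup>3 p\<^sup>2))\<close> each, and \<open>\<Sum>\<^sub>p\<^sub>>\<^sub>M p\<^sup>-\<^sup>2 = O(1/(M log M))\<close>; for every \<open>s\<close> with \<open>K(s) \<noteq> 0\<close> there are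
  \<open>O(T/(log R + log T))\<close> prime divisors \<open>p > R\<close> of \<open>K(s)\<close>, each with \<open>O(B/(m\<^sup>2 R))\<close> values \<open>t\<close>; and
  \<open>K(s) = 0\<close> has boundedly many solutions. If \<open>A < m\<close>, \<open>B < m\<^sup>2\<close> or \<open>M\<close> is bounded, the trivial bound suffices.\<close>

section \<open>Discriminants under scaling and vanishing leading coefficient\<close>

text \<open>In the Leibniz expansion every term takes one entry from each row and each column, so
  the weights factor out as the same product for all permutations. Weights on both sides avoid
  division.\<close>

lemma det_scale:
  fixes A B :: "'a::comm_ring_1 mat"
  assumes A: "A \<in> carrier_mat N N" and B: "B \<in> carrier_mat N N"
    and AB: "\<And>i j. i < N \<Longrightarrow> j < N \<Longrightarrow> u i * v j * A $$ (i, j) = w i * z j * B $$ (i, j)"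
  shows "(\<Prod>i<N. u i) * (\<Prod>j<N. v j) * det A = (\<Prod>i<N. w i) * (\<Prod>j<N. z j) * det B"
proof -
  have *: "(\<Prod>i<N. x i) * (\<Prod>j<N. y j) * det M =
      (\<Sum>p | p permutes {0..<N}. signof p * (\<Prod>i = 0..<N. x i * y (p i) * M $$ (i, p i)))"
    if "M \<in> carrier_mat N N" for x y and M :: "'a mat"
  proof -
    have "(\<Prod>j = 0..<N. y j) = (\<Prod>i = 0..<N. y (p i))" if "p permutes {0..<N}" for p
      using prod.permute[OF that, of y] by (simp add: o_def)
    thus ?thesis
      unfolding det_def'[OF that] sum_distrib_left
      by (intro sum.cong) (auto simp: prod.distrib lessThan_atLeast0 mult_ac)
  qed
  show ?thesis
    unfolding *[OF A] *[OF B]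
    using permutes_in_image[of _ "{0..<N}"]
    by (intro sum.cong refl arg_cong2[where f = "(*)"] prod.cong AB) auto
qed

text \<open>The discriminant is homogeneous of degree 2d - 2 and isobaric of weight d(d - 1). Each
  entry of \<open>disc_mat\<close> outside column 0 gains a factor \<open>\<mu>\<close> and a power
  of \<open>\<nu>\<close> given by column minus row shift; column 0, from which \<open>c 0\<close>
  has been divided out, is unchanged.\<close>

lemma disc_scale:
  fixes c :: "nat \<Rightarrow> 'a::idom"
  assumes d: "d \<ge> 1" and "\<mu> \<noteq> 0" "\<nu> \<noteq> 0"
  shows "disc d (\<lambda>i. \<mu> * \<nu> ^ i * c i) = \<mu> ^ (2 * d - 2) * \<nu> ^ (d * (d - 1)) * disc d c"
proof -
  define N where "N = 2 * d - 1"
  \<comment> \<open>\<open>r i\<close> is the shift of row \<open>i\<close> within its block: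
    outside column 0, the entry in column \<open>j\<close> is a numerical multiple of
    \<open>c (j - r i)\<close>. The nonzero entries of column 0 lie in rows of shift 0.\<close>
  define r where "r = (\<lambda>i. if i < d - 1 then i else i - (d - 1))"
  let ?M' = "disc_mat d (\<lambda>i. \<mu> * \<nu> ^ i * c i)" and ?M = "disc_mat d c"
  have carr: "?M' \<in> carrier_mat N N" "?M \<in> carrier_mat N N"
    unfolding N_def by (rule disc_mat_carrier)+
  have "(\<Prod>i<N. \<nu> ^ r i) * (\<Prod>j<N. if j = 0 then \<mu> else 1) * det ?M'
    = (\<Prod>i<N. \<mu>) * (\<Prod>j<N. \<nu> ^ j) * det ?M"
  proof (rule det_scale[OF carr])
    fix i j assume ij: "i < N" "j < N"
    show "\<nu> ^ r i * (if j = 0 then \<mu> else 1) * ?M' $$ (i, j) = \<mu> * \<nu> ^ j * ?M $$ (i, j)"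
    proof (cases "j = 0")
      case True
      thus ?thesis using ij by (auto simp: disc_mat_def N_def r_def)
    next
      case False
      have pow: "\<nu> ^ a * \<nu> ^ (j - a) = \<nu> ^ j" if "a \<le> j" for a
        using that by (simp flip: power_add)
      show ?thesis
      proof (cases "i < d - 1")
        case True
        have "d - (d + i - j) = j - i" if "i \<le> j" "j \<le> d + i" using that by auto
        thus ?thesis using True ij False d pow[of i]
          by (auto simp: disc_mat_def N_def r_def sylvester_mat_sub_index coeff_dehom_form mult_ac)
      next
        case i: False
        define a where "a = i - (d - 1)"
        have i_eq: "i = d - 1 + a" using i by (simp add: a_def)
        have e: "disc_mat d k $$ (i, j) = (if a \<le> j \<and> j \<le> d - 1 + a then of_nat (d - (j - a)) * k (j - a) else 0)"
          for k :: "nat \<Rightarrow> 'a"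
        proof -
          have "disc_mat d k $$ (i, j)
            = (if a \<le> j \<and> j \<le> i then coeff (pderiv (dehom_form d k)) (i - j) else 0)"
            using ij False i d by (auto simp: disc_mat_def N_def sylvester_mat_sub_index i_eq)
          moreover have "Suc (i - j) = d - (j - a)" if "a \<le> j" "j \<le> i"
            using that d ij by (auto simp: i_eq)
          ultimately show ?thesis
            by (auto simp: coeff_pderiv coeff_dehom_form i_eq simp del: of_nat_Suc)
        qed
        have "r i = a" using i by (simp add: r_def a_def)
        thus ?thesis using False pow[of a] by (auto simp: e)
      qed
    qed
  qed
  moreover have "(\<Prod>i<N. \<nu> ^ r i) = \<nu> ^ ((d - 1) * (d - 1))"
  proof -
    have "(\<Sum>i<e + k. if i < e then i else i - e) = (\<Sum>i<e. i) + (\<Sum>i<k. i)" for e k :: nat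
      by (induction k) auto
    from this[of "d - 1" d] have "(\<Sum>i<N. r i) = (\<Sum>i<d - 1. i) + (\<Sum>i<d. i)"
      using d by (simp add: r_def N_def mult_2)
    also have "(\<Sum>i<d. i) = (\<Sum>i<d - 1. i) + (d - 1)"
      using d by (cases d) auto
    also have "(\<Sum>i<d - 1. i) + ((\<Sum>i<d - 1. i) + (d - 1)) = (d - 1) * (d - 1)"
    proof -
      have "(\<Sum>i<e. i) + ((\<Sum>i<e. i) + e) = e * e" for e :: nat by (induction e) auto
      thus ?thesis .
    qed
    finally show ?thesis by (simp flip: power_sum)
  qed
  \<comment> \<open>The column weights are split so that the row weights (d - 1)^2 cancel and the
    weight d(d - 1) remains.\<close>
  moreover have "(\<Prod>j<N. \<nu> ^ j) = \<nu> ^ ((d - 1) * (d - 1) + d * (d - 1))"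
  proof -
    have "(\<Sum>i<2 * e + 1. i) = e * e + (e + 1) * e" for e :: nat by (induction e) auto
    from this[of "d - 1"] have "(\<Sum>i<N. i) = (d - 1) * (d - 1) + d * (d - 1)"
      using d by (cases d) (simp_all add: N_def)
    thus ?thesis by (simp flip: power_sum)
  qed
  moreover have "(\<Prod>j<N. if j = 0 then \<mu> else 1) = \<mu>"
    using d by (simp add: N_def)
  moreover have "(\<Prod>i<N. \<mu>) = \<mu> * \<mu> ^ (2 * d - 2)"
  proof -
    have "N = Suc (2 * d - 2)" using d by (simp add: N_def)
    thus ?thesis by simp
  qed
  ultimately show ?thesis
    using assms by (simp add: power_add disc_def mult_ac)
qed

text \<open>A root has moved to infinity. Column 0 holds only 1 and d; after d times row 0 is
  subtracted from row d - 1, two expansions along the first column use the pivots 1 and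
  \<open>- c 1\<close> and leave the Sylvester matrix for formal degrees d - 1 and d - 2.\<close>

lemma disc_leading_zero:
  fixes c :: "nat \<Rightarrow> 'a::idom"
  assumes d: "d \<ge> 2" and c0: "c 0 = 0"
  shows "disc d c = (c 1)\<^sup>2 * disc (d - 1) (\<lambda>i. c (Suc i))"
proof -
  define N where "N = 2 * d - 1"
  define M where "M = disc_mat d c"
  define A where "A = addrow (- of_nat d) (d - 1) 0 M"
  define A1 where "A1 = mat_delete A 0 0"
  define S where "S = sylvester_mat_sub (d - 1) (d - 2) (dehom_form d c) (pderiv (dehom_form d c))"
  have F: "dehom_form d c = dehom_form (d - 1) (\<lambda>i. c (Suc i))"
    using d c0 by (intro poly_eqI) (auto simp: coeff_dehom_form Suc_diff_Suc)
  have M: "M \<in> carrier_mat N N" unfolding M_def N_def by (rule disc_mat_carrier)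
  have A: "A \<in> carrier_mat N N" using M by (simp add: A_def)
  have A1: "A1 \<in> carrier_mat (N - 1) (N - 1)" using A by (simp add: A1_def mat_delete_def)
  have A_ij: "A $$ (i, j) = (if i = d - 1 then - of_nat d * M $$ (0, j) + M $$ (i, j) else M $$ (i, j))"
    if "i < N" "j < N" for i j
    using M that by (simp add: A_def mat_addrow_def)
  have "det M = det A"
    unfolding A_def using det_addrow[of 0 N "d - 1" M] M d by (simp add: N_def)
  also have "\<dots> = (\<Sum>i<N. A $$ (i, 0) * cofactor A i 0)"
    by (rule laplace_expansion_column[OF A]) (use d in \<open>auto simp: N_def\<close>)
  also have "\<dots> = (\<Sum>i<N. if i = 0 then det A1 else 0)"
  proof (rule sum.cong[OF refl])
    fix i assume "i \<in> {..<N}"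
    thus "A $$ (i, 0) * cofactor A i 0 = (if i = 0 then det A1 else 0)"
      using d by (auto simp: A_ij M_def disc_mat_def N_def cofactor_def A1_def)
  qed
  also have "\<dots> = det A1" using d by (simp add: N_def)
  also have "\<dots> = (\<Sum>i<N - 1. A1 $$ (i, 0) * cofactor A1 i 0)"
    by (rule laplace_expansion_column[OF A1]) (use d in \<open>auto simp: N_def\<close>)
  \<comment> \<open>Below row 0, the only entry of column 1 that is not a multiple of
    \<open>c 0\<close> was (d - 1) c_1 in row d - 1; the row operation has turned it into
    \<open>- c 1\<close>.\<close>
  also have "\<dots> = (\<Sum>i<N - 1. if i = d - 2 then - c 1 * cofactor A1 i 0 else 0)"
  proof (rule sum.cong[OF refl])
    fix i assume "i \<in> {..<N - 1}"
    hence i: "i < N - 1" by simp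
    hence "A1 $$ (i, 0) = A $$ (Suc i, 1)"
      using A by (simp add: A1_def mat_delete_def)
    also have "\<dots> = (if i = d - 2 then - c 1 else 0)"
    proof -
      obtain e where e: "d = Suc (Suc e)" using d by (metis Suc_le_D numeral_2_eq_2 Suc_le_mono)
      show ?thesis
        using i c0 by (auto simp: A_ij M_def disc_mat_def N_def sylvester_mat_sub_index coeff_dehom_form
          coeff_pderiv e algebra_simps)
    qed
    finally show "A1 $$ (i, 0) * cofactor A1 i 0 = (if i = d - 2 then - c 1 * cofactor A1 i 0 else 0)"
      by simp
  qed
  also have "\<dots> = - c 1 * cofactor A1 (d - 2) 0"
    using d by (auto simp: N_def)
  also have "cofactor A1 (d - 2) 0 = (-1) ^ d * det S"
  proof -
    have "mat_delete A1 (d - 2) 0 = S"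
    proof (rule eq_matI, goal_cases)
      case (1 i j)
      hence ij: "i < 2 * d - 3" "j < 2 * d - 3" using d by (auto simp: S_def)
      obtain e where e: "d = Suc (Suc e)" using d by (metis Suc_le_D numeral_2_eq_2 Suc_le_mono)
      have coeff_F: "coeff (dehom_form (Suc (Suc e)) c) k = 0" if "k > Suc e" for k
        using that c0 by (auto simp: coeff_dehom_form)
      hence coeff_F': "coeff (pderiv (dehom_form (Suc (Suc e)) c)) k = 0" if "k > e" for k
        using that by (simp add: coeff_pderiv)
      have "mat_delete A1 (d - 2) 0 $$ (i, j) = A $$ (if i < d - 2 then Suc i else Suc (Suc i), Suc (Suc j))"
        using ij A A1 d by (auto simp: mat_delete_def A1_def N_def)
      also have "\<dots> = S $$ (i, j)"
        using ij c0 coeff_F coeff_F' by (auto simp: A_ij M_def S_def disc_mat_def N_def sylvester_mat_sub_index e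
          Suc_diff_le)
      finally show ?case .
    qed (use A1 d in \<open>auto simp: S_def mat_delete_def N_def\<close>)
    moreover have "(-1) ^ (d - 2) = ((-1) ^ d :: 'a)"
      using d by (simp add: minus_one_power_iff)
    ultimately show ?thesis by (simp add: cofactor_def)
  qed
  finally have "det M = (-1) ^ (d - 1) * c 1 * det S"
    using d by (cases d) auto
  \<comment> \<open>The remaining determinant is again a resultant of a form and its derivative,
    which supplies the second factor \<open>c 1\<close>.\<close>
  moreover have "c 1 * disc (d - 1) (\<lambda>i. c (Suc i)) = (-1) ^ ((d - 1) choose 2) * det S"
    using disc_resultant[of "d - 1" "\<lambda>i. c (Suc i)"] d
    by (simp add: S_def resultant_sub_def F numeral_2_eq_2)
  moreover have "d choose 2 = (d - 1) + ((d - 1) choose 2)"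
    using d by (cases d) (auto simp: numeral_2_eq_2)
  ultimately show ?thesis
    by (simp add: disc_def M_def power_add power2_eq_square algebra_simps)
qed

section \<open>Homogeneity and weight of \<open>Ksh\<close>\<close>

lemma Ksh_cong: "(\<And>i. i < n \<Longrightarrow> x i = y i) \<Longrightarrow> Ksh n x = Ksh n y"
  unfolding Ksh_def
  by (intro disc_cong arg_cong2[where f = coeff] refl) (simp cong: if_cong)

text \<open>With \<open>\<rho>\<close> the factor belonging to X_n, the inner discriminants satisfy
  D_y(\<open>\<rho>\<close> X) = \<open>\<sigma>\<close> D_x(X) by \<open>disc_scale\<close>. Their
  coefficients therefore scale geometrically as well, and \<open>disc_scale\<close> applies again to
  the outer discriminant.\<close>

lemma Ksh_scale:
  fixes x :: "nat \<Rightarrow> 'a::idom"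
  assumes n: "n \<ge> 2" and \<mu>: "\<mu> \<noteq> 0" and \<nu>: "\<nu> \<noteq> 0"
  shows "Ksh n (\<lambda>i. \<mu> * \<nu> ^ i * x i)
    = \<mu> ^ (3 * (n - 1) * (n - 2)) * \<nu> ^ (n * (n - 1) * (n - 2)) * Ksh n x"
proof -
  define D where "D = (\<lambda>x. disc n (\<lambda>j. if j < n then [:x j:] else [:0, 1::'a:]))"
  define y where "y = (\<lambda>i. \<mu> * \<nu> ^ i * x i)"
  define \<rho> where "\<rho> = \<mu> * \<nu> ^ n"
  define \<sigma> where "\<sigma> = \<mu> ^ (2 * n - 2) * \<nu> ^ (n * (n - 1))"
  have nz: "\<rho> \<noteq> 0" "\<sigma> \<noteq> 0" using \<mu> \<nu> by (auto simp: \<rho>_def \<sigma>_def)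
  have hom: "idom_hom (\<lambda>q. q \<circ>\<^sub>p [:0, \<rho>:])" ..
  have "D y \<circ>\<^sub>p [:0, \<rho>:] = disc n (\<lambda>j. [:\<mu>:] * [:\<nu>:] ^ j * (if j < n then [:x j:] else [:0, 1:]))"
    unfolding D_def idom_hom.hom_disc[OF hom]
    by (rule disc_cong) (auto simp: y_def \<rho>_def pcompose_pCons poly_const_pow mult_ac)
  also have "\<dots> = smult \<sigma> (D x)"
    by (subst disc_scale) (use n \<mu> \<nu> in \<open>auto simp: D_def \<sigma>_def poly_const_pow mult_ac\<close>)
  finally have eq: "D y \<circ>\<^sub>p [:0, \<rho>:] = smult \<sigma> (D x)" .
  have coeffs: "\<rho> ^ k * coeff (D y) k = \<sigma> * coeff (D x) k" for k
    using arg_cong[OF eq, of "\<lambda>p. coeff p k"] by (simp add: coeff_pcompose_linear)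
  \<comment> \<open>Only \<open>\<rho> ^ k * coeff (D y) k\<close> is known. All coefficients are
    first multiplied by \<open>\<rho> ^ (n - 1)\<close>, so that the one of index n - 1 - i has the
    surplus \<open>\<rho> ^ i\<close>; the extra powers are cancelled afterwards.\<close>
  have "\<rho> ^ ((n - 1) * (2 * n - 4)) * Ksh n y = disc (n - 1) (\<lambda>i. \<rho> ^ (n - 1) * 1 ^ i * coeff (D y) (n - 1 - i))"
    using disc_scale[of "n - 1" "\<rho> ^ (n - 1)" 1] n nz
    by (simp add: Ksh_def D_def diff_mult_distrib2 flip: power_mult)
  also have "\<dots> = disc (n - 1) (\<lambda>i. \<sigma> * \<rho> ^ i * coeff (D x) (n - 1 - i))"
  proof (rule disc_cong)
    fix i assume i: "i \<le> n - 1"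
    have "\<rho> ^ (n - 1) * coeff (D y) (n - 1 - i) = \<rho> ^ i * (\<rho> ^ (n - 1 - i) * coeff (D y) (n - 1 - i))"
    proof -
      have "i + (n - 1 - i) = n - 1" using i by simp
      thus ?thesis by (metis mult.assoc power_add)
    qed
    thus "\<rho> ^ (n - 1) * 1 ^ i * coeff (D y) (n - 1 - i) = \<sigma> * \<rho> ^ i * coeff (D x) (n - 1 - i)"
      by (simp add: coeffs)
  qed
  also have "\<dots> = \<sigma> ^ (2 * (n - 1) - 2) * \<rho> ^ ((n - 1) * (n - 1 - 1)) * disc (n - 1) (\<lambda>i. coeff (D x) (n - 1 - i))"
    by (rule disc_scale) (use n nz in auto)
  also have "2 * (n - 1) - 2 = 2 * n - 4" by simp
  also have "n - 1 - 1 = n - 2" by simp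
  also have "disc (n - 1) (\<lambda>i. coeff (D x) (n - 1 - i)) = Ksh n x"
    by (simp only: Ksh_def D_def)
  finally have main: "\<rho> ^ ((n - 1) * (2 * n - 4)) * Ksh n y = \<sigma> ^ (2 * n - 4) * \<rho> ^ ((n - 1) * (n - 2)) * Ksh n x" .
  obtain m where m: "n = m + 2" using n by (metis add.commute le_iff_add)
  have "\<rho> ^ ((n - 1) * (2 * n - 4)) = \<rho> ^ ((n - 1) * (n - 2)) * \<rho> ^ ((n - 1) * (n - 2))"
  proof -
    have "(n - 1) * (2 * n - 4) = (n - 1) * (n - 2) + (n - 1) * (n - 2)" by (simp add: m algebra_simps)
    thus ?thesis by (simp only: power_add)
  qed
  hence "\<rho> ^ ((n - 1) * (n - 2)) * Ksh n y = \<sigma> ^ (2 * n - 4) * Ksh n x"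
    using main nz by (simp add: mult_ac)
  also have "\<sigma> ^ (2 * n - 4)
      = \<rho> ^ ((n - 1) * (n - 2)) * (\<mu> ^ (3 * (n - 1) * (n - 2)) * \<nu> ^ (n * (n - 1) * (n - 2)))"
  proof -
    have 1: "\<sigma> ^ (2 * n - 4) = \<mu> ^ ((2 * n - 2) * (2 * n - 4)) * \<nu> ^ (n * (n - 1) * (2 * n - 4))"
      by (simp add: \<sigma>_def power_mult_distrib power_mult)
    have 2: "\<rho> ^ ((n - 1) * (n - 2)) = \<mu> ^ ((n - 1) * (n - 2)) * \<nu> ^ (n * ((n - 1) * (n - 2)))"
      by (simp add: \<rho>_def power_mult_distrib power_mult)
    have 3: "(2 * n - 2) * (2 * n - 4) = (n - 1) * (n - 2) + 3 * (n - 1) * (n - 2)"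
      "n * (n - 1) * (2 * n - 4) = n * ((n - 1) * (n - 2)) + n * (n - 1) * (n - 2)"
      by (simp_all add: m algebra_simps)
    show ?thesis unfolding 1 2 3 power_add by (simp only: mult_ac)
  qed
  finally show ?thesis using nz by (simp add: y_def mult_ac)
qed

section \<open>Leading coefficients of \<open>disc\<close> and \<open>Ksh\<close> in the last variable\<close>

text \<open>\<open>Q\<close> is \<open>K\<close> with its coefficients deformed by an inner indeterminate \<open>\<lambda>\<close> of weight 1 (the main variable
  has weight \<open>w\<close>). The coefficient of \<open>x^k\<close> has the full weight \<open>w k\<close>, so it is independent of \<open>\<lambda>\<close> and
  can be read off at \<open>\<lambda> = 0\<close>.\<close>

lemma coeff_eq_of_weighted_homogeneous:
  fixes K :: "'a::idom poly" and Q :: "'a poly poly"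
  assumes w: "w > 0"
    and Q: "Q \<circ>\<^sub>p [:0, monom 1 w:] = smult (monom 1 (w * k)) (map_poly (\<lambda>r. [:r:]) K)"
  shows "degree K \<le> k" "coeff K k = coeff (map_poly (\<lambda>q. poly q 0) Q) k"
    "Q = map_poly (\<lambda>r. [:r:]) K \<Longrightarrow> K = monom (coeff K k) k"
proof -
  \<comment> \<open>Comparing the coefficients of x^i gives \<lambda>^(w i) Q_i(\<lambda>) = K_i
    \<lambda>^(w k). For i > k the left side has no term \<lambda>^(w k); for i = k the power
    cancels; and if Q_i is the constant K_i, then K_i = 0 unless i = k.\<close>
  have coeffs: "monom 1 (w * i) * coeff Q i = monom (coeff K i) (w * k)" for i
  proof -
    have "coeff (Q \<circ>\<^sub>p [:0, monom 1 w:]) i = coeff (smult (monom 1 (w * k)) (map_poly (\<lambda>r. [:r:]) K)) i"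
      by (simp only: Q)
    also have "\<dots> = monom (coeff K i) (w * k)"
      by (simp add: coeff_map_poly mult_monom flip: monom_0)
    finally show ?thesis
      by (simp add: coeff_pcompose_linear monom_power)
  qed
  have "coeff K i = 0" if "i > k" for i
  proof -
    have "coeff (monom 1 (w * i) * coeff Q i) (w * k) = 0"
      using that w by (simp add: coeff_monom_mult)
    thus ?thesis using coeffs[of i] by simp
  qed
  thus "degree K \<le> k" by (intro degree_le) simp
  have "coeff (monom 1 (w * k) * coeff Q k) (w * k) = poly (coeff Q k) 0"
    by (simp add: coeff_monom_mult poly_0_coeff_0)
  thus "coeff K k = coeff (map_poly (\<lambda>q. poly q 0) Q) k"
    using coeffs[of k] by (simp add: coeff_map_poly)
  show "K = monom (coeff K k) k" if "Q = map_poly (\<lambda>r. [:r:]) K"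
  proof (rule poly_eqI)
    fix i
    have "monom (coeff K i) (w * i) = monom (coeff K i) (w * k)"
      using coeffs[of i] by (simp add: that coeff_map_poly mult_monom flip: monom_0)
    hence "coeff (monom (coeff K i) (w * i)) (w * i) = coeff (monom (coeff K i) (w * k)) (w * i)"
      by simp
    thus "coeff K i = coeff (monom (coeff K k) k) i"
      using w by (cases "i = k") auto
  qed
qed

text \<open>This is D(s, .) as a polynomial in the last coefficient, and at the same time the inner
  discriminant of \<open>Ksh\<close>; its value does not depend on \<open>x n\<close>.\<close>

definition disc_poly :: "nat \<Rightarrow> (nat \<Rightarrow> 'a::idom) \<Rightarrow> 'a poly" where
  "disc_poly n x = disc n (\<lambda>j. if j < n then [:x j:] else [:0, 1:])"

definition Ksh_poly :: "nat \<Rightarrow> (nat \<Rightarrow> 'a::idom) \<Rightarrow> 'a poly" where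
  "Ksh_poly n x = Ksh n (\<lambda>j. if j < n - 1 then [:x j:] else [:0, 1:])"

lemma poly_disc_poly: "poly (disc_poly n x) t = disc n (x(n := t))"
  unfolding disc_poly_def poly_hom.hom_disc by (rule disc_cong) auto

lemma poly_Ksh_poly:
  assumes "n \<ge> 1"
  shows "poly (Ksh_poly n x) s = Ksh n (x(n - 1 := s))"
  unfolding Ksh_poly_def poly_hom.hom_Ksh by (rule Ksh_cong) (use assms in auto)

lemma degree_disc_poly: "n \<ge> 1 \<Longrightarrow> degree (disc_poly n x) \<le> n - 1"
  unfolding disc_poly_def by (rule degree_disc_last)

lemma idom_hom_map_const: "idom_hom (map_poly (\<lambda>r. [:r :: 'a :: idom:]))"
proof -
  interpret map_poly_idom_hom "\<lambda>r. [:r :: 'a:]"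
    by unfold_locales (simp_all add: one_pCons)
  show ?thesis ..
qed

lemma idom_hom_map_eval0: "idom_hom (map_poly (\<lambda>q. poly q (0 :: 'a :: idom)))"
proof -
  interpret map_poly_idom_hom "\<lambda>q. poly q (0::'a)" ..
  show ?thesis ..
qed

lemma map_eval0_pCons:
  fixes c :: "'a::idom poly"
  shows "map_poly (\<lambda>q. poly q 0) (pCons c p) = pCons (poly c 0) (map_poly (\<lambda>q. poly q 0) p)"
  by (intro poly_eqI) (simp add: coeff_map_poly coeff_pCons split: nat.split)

lemma map_const_pCons:
  fixes c :: "'a::idom"
  shows "map_poly (\<lambda>r. [:r:]) (pCons c p) = pCons [:c:] (map_poly (\<lambda>r. [:r:]) p)"
  by (intro poly_eqI) (simp add: coeff_map_poly coeff_pCons split: nat.split)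

lemma const_monom_power: "[:monom (1::'a::idom) (Suc 0):] ^ j = [:monom 1 j:]"
  by (simp add: poly_const_pow monom_power)

text \<open>With weight j for \<open>x j\<close> and weight n for X_n, all coefficients of the form
  scale as in \<open>disc_scale\<close> with \<open>\<nu>\<close> = \<lambda>. This gives the
  hypothesis of \<open>coeff_eq_of_weighted_homogeneous\<close> for k = n - 1; at \<lambda> = 0 only
  \<open>x 0\<close> survives.\<close>

lemma disc_poly_weighted:
  fixes x :: "nat \<Rightarrow> 'a::idom"
  assumes n: "n \<ge> 1"
  defines "Q \<equiv> disc_poly n (\<lambda>j. monom (x j) j)"
  shows "Q \<circ>\<^sub>p [:0, monom 1 n:] = smult (monom 1 (n * (n - 1))) (map_poly (\<lambda>r. [:r:]) (disc_poly n x))"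
    and "map_poly (\<lambda>q. poly q 0) Q = disc_poly n (\<lambda>j. if j = 0 then x 0 else 0)"
proof -
  have hom: "idom_hom (\<lambda>q. q \<circ>\<^sub>p [:0, monom (1::'a) n:])" ..
  have "Q \<circ>\<^sub>p [:0, monom 1 n:]
      = disc n (\<lambda>j. 1 * [:monom 1 1:] ^ j * map_poly (\<lambda>r. [:r:]) (if j < n then [:x j:] else [:0, 1:]))"
    unfolding Q_def disc_poly_def idom_hom.hom_disc[OF hom]
    by (rule disc_cong)
      (auto simp: pcompose_pCons map_const_pCons const_monom_power smult_monom)
  also have "\<dots> = 1 ^ (2 * n - 2) * [:monom 1 1:] ^ (n * (n - 1)) *
      disc n (\<lambda>j. map_poly (\<lambda>r. [:r:]) (if j < n then [:x j:] else [:0, 1:]))"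
    by (rule disc_scale) (use n in auto)
  also have "\<dots> = smult (monom 1 (n * (n - 1))) (map_poly (\<lambda>r. [:r:]) (disc_poly n x))"
    by (simp add: disc_poly_def idom_hom.hom_disc[OF idom_hom_map_const] poly_const_pow monom_power)
  finally show "Q \<circ>\<^sub>p [:0, monom 1 n:] = smult (monom 1 (n * (n - 1))) (map_poly (\<lambda>r. [:r:]) (disc_poly n x))" .
  show "map_poly (\<lambda>q. poly q 0) Q = disc_poly n (\<lambda>j. if j = 0 then x 0 else 0)"
    unfolding Q_def disc_poly_def idom_hom.hom_disc[OF idom_hom_map_eval0]
    by (rule disc_cong) (auto simp: map_eval0_pCons poly_monom)
qed

text \<open>The same for \<open>Ksh\<close>, whose main variable has weight n - 1; the total weight
  n(n - 1)(n - 2) gives k = n(n - 2).\<close>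

lemma Ksh_poly_weighted:
  fixes x :: "nat \<Rightarrow> 'a::idom"
  assumes n: "n \<ge> 2"
  defines "Q \<equiv> Ksh_poly n (\<lambda>j. monom (x j) j)"
  shows "Q \<circ>\<^sub>p [:0, monom 1 (n - 1):]
      = smult (monom 1 ((n - 1) * (n * (n - 2)))) (map_poly (\<lambda>r. [:r:]) (Ksh_poly n x))"
    and "map_poly (\<lambda>q. poly q 0) Q = Ksh_poly n (\<lambda>j. if j = 0 then x 0 else 0)"
proof -
  have hom: "idom_hom (\<lambda>q. q \<circ>\<^sub>p [:0, monom (1::'a) (n - 1):])" ..
  have "Q \<circ>\<^sub>p [:0, monom 1 (n - 1):]
      = Ksh n (\<lambda>j. 1 * [:monom 1 1:] ^ j * map_poly (\<lambda>r. [:r:]) (if j < n - 1 then [:x j:] else [:0, 1:]))"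
    unfolding Q_def Ksh_poly_def idom_hom.hom_Ksh[OF hom]
  proof (rule Ksh_cong)
    fix j assume "j < n"
    hence "j < n - 1 \<or> j = n - 1" by auto
    thus "(if j < n - 1 then [:monom (x j) j:] else [:0, 1:]) \<circ>\<^sub>p [:0, monom 1 (n - 1):]
      = 1 * [:monom 1 1:] ^ j * map_poly (\<lambda>r. [:r:]) (if j < n - 1 then [:x j:] else [:0, 1:])"
      by (auto simp: pcompose_pCons map_const_pCons const_monom_power smult_monom)
  qed
  also have "\<dots> = 1 ^ (3 * (n - 1) * (n - 2)) * [:monom 1 1:] ^ (n * (n - 1) * (n - 2)) *
      Ksh n (\<lambda>j. map_poly (\<lambda>r. [:r:]) (if j < n - 1 then [:x j:] else [:0, 1:]))"
    by (rule Ksh_scale) (use n in auto)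
  also have "\<dots> = smult (monom 1 ((n - 1) * (n * (n - 2)))) (map_poly (\<lambda>r. [:r:]) (Ksh_poly n x))"
    by (simp add: Ksh_poly_def idom_hom.hom_Ksh[OF idom_hom_map_const] poly_const_pow monom_power mult_ac)
  finally show "Q \<circ>\<^sub>p [:0, monom 1 (n - 1):]
      = smult (monom 1 ((n - 1) * (n * (n - 2)))) (map_poly (\<lambda>r. [:r:]) (Ksh_poly n x))" .
  show "map_poly (\<lambda>q. poly q 0) Q = Ksh_poly n (\<lambda>j. if j = 0 then x 0 else 0)"
    unfolding Q_def Ksh_poly_def idom_hom.hom_Ksh[OF idom_hom_map_eval0]
    by (rule Ksh_cong) (use n in \<open>auto simp: map_eval0_pCons poly_monom\<close>)
qed

lemma map_const_disc_poly: "map_poly (\<lambda>r. [:r:]) (disc_poly n x) = disc_poly n (\<lambda>j. [:x j:])"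
  unfolding disc_poly_def idom_hom.hom_disc[OF idom_hom_map_const]
  by (rule disc_cong) (auto simp: map_const_pCons)

lemma map_const_Ksh_poly: "map_poly (\<lambda>r. [:r:]) (Ksh_poly n x) = Ksh_poly n (\<lambda>j. [:x j:])"
  unfolding Ksh_poly_def idom_hom.hom_Ksh[OF idom_hom_map_const]
  by (rule Ksh_cong) (auto simp: map_const_pCons)

text \<open>The top coefficient has the full weight, so it depends on \<open>x 0\<close> alone and
  the other entries may be set to 0. Homogeneity extracts the power of \<open>x 0\<close>. The
  discriminant of X^n + t is a monomial in t, so its coefficient is the value at t = 1.\<close>

lemma coeff_disc_poly_top:
  fixes x :: "nat \<Rightarrow> 'a::idom"
  assumes n: "n \<ge> 1" and x0: "x 0 \<noteq> 0"
  shows "coeff (disc_poly n x) (n - 1) = x 0 ^ (n - 1) * disc n (\<lambda>j. if j = 0 \<or> j = n then 1 else 0)"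
proof -
  define e where "e = (\<lambda>a j. if j = (0::nat) then a else (0::'a))"
  have w: "n > 0" using n by simp
  have "coeff (disc_poly n x) (n - 1) = coeff (disc_poly n (e (x 0))) (n - 1)"
    using coeff_eq_of_weighted_homogeneous(2)[OF w disc_poly_weighted(1)[OF n]]
    unfolding disc_poly_weighted(2)[OF n] e_def by blast
  also have "\<dots> = x 0 ^ (n - 1) * coeff (disc_poly n (e 1)) (n - 1)"
  proof -
    have hom: "idom_hom (\<lambda>q. q \<circ>\<^sub>p [:0, x 0:])" ..
    \<comment> \<open>Replacing X_n by x_0 X_n makes all coefficients of the form multiples of
      \<open>x 0\<close>, so that homogeneity of degree 2n - 2 applies.\<close>
    have "disc_poly n (e (x 0)) \<circ>\<^sub>p [:0, x 0:]
        = disc n (\<lambda>j. [:x 0:] * 1 ^ j * (if j < n then [:e 1 j:] else [:0, 1:]))"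
      unfolding disc_poly_def idom_hom.hom_disc[OF hom]
      by (rule disc_cong) (auto simp: e_def pcompose_pCons)
    also have "\<dots> = smult (x 0 ^ (2 * n - 2)) (disc_poly n (e 1))"
      by (subst disc_scale) (use n x0 in \<open>auto simp: disc_poly_def poly_const_pow\<close>)
    finally have "x 0 ^ (n - 1) * coeff (disc_poly n (e (x 0))) (n - 1)
        = x 0 ^ (2 * n - 2) * coeff (disc_poly n (e 1)) (n - 1)"
      by (metis coeff_pcompose_linear coeff_smult)
    moreover have "x 0 ^ (2 * n - 2) = x 0 ^ (n - 1) * x 0 ^ (n - 1)"
    proof -
      have "2 * n - 2 = (n - 1) + (n - 1)" by simp
      thus ?thesis by (simp only: power_add)
    qed
    ultimately show ?thesis using x0 by simp
  qed
  also have "coeff (disc_poly n (e 1)) (n - 1) = poly (disc_poly n (e 1)) 1"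
  proof -
    have "disc_poly n (\<lambda>j. monom (e 1 j) j) = map_poly (\<lambda>r. [:r:]) (disc_poly n (e 1))"
      unfolding map_const_disc_poly
      by (rule arg_cong[where f = "disc_poly n"]) (auto simp: e_def monom_0)
    from coeff_eq_of_weighted_homogeneous(3)[OF w disc_poly_weighted(1)[OF n] this]
    show ?thesis by (metis mult.right_neutral poly_monom power_one)
  qed
  also have "\<dots> = disc n (\<lambda>j. if j = 0 \<or> j = n then 1 else 0)"
    unfolding poly_disc_poly by (rule disc_cong) (use n in \<open>auto simp: e_def\<close>)
  finally show ?thesis .
qed

text \<open>As for the discriminant, now with degree 3(n - 1)(n - 2): the substitution uses up n(n -
  2) factors \<open>x 0\<close> and leaves (n - 2)(2n - 3). The constant belongs to the family X^n +
  X + X_n.\<close>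

lemma coeff_Ksh_poly_top:
  fixes x :: "nat \<Rightarrow> 'a::idom"
  assumes n: "n \<ge> 2" and x0: "x 0 \<noteq> 0"
  shows "coeff (Ksh_poly n x) (n * (n - 2)) = x 0 ^ ((n - 2) * (2 * n - 3)) * Ksh n (\<lambda>j. if j = 0 \<or> j = n - 1 then 1 else 0)"
proof -
  define e where "e = (\<lambda>a j. if j = (0::nat) then a else (0::'a))"
  have n1: "n \<ge> 1" using n by simp
  have w: "n - 1 > 0" using n by simp
  have "coeff (Ksh_poly n x) (n * (n - 2)) = coeff (Ksh_poly n (e (x 0))) (n * (n - 2))"
    using coeff_eq_of_weighted_homogeneous(2)[OF w Ksh_poly_weighted(1)[OF n]]
    unfolding Ksh_poly_weighted(2)[OF n] e_def by blast
  also have "\<dots> = x 0 ^ ((n - 2) * (2 * n - 3)) * coeff (Ksh_poly n (e 1)) (n * (n - 2))"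
  proof -
    have hom: "idom_hom (\<lambda>q. q \<circ>\<^sub>p [:0, x 0:])" ..
    have "Ksh_poly n (e (x 0)) \<circ>\<^sub>p [:0, x 0:]
        = Ksh n (\<lambda>j. [:x 0:] * 1 ^ j * (if j < n - 1 then [:e 1 j:] else [:0, 1:]))"
      unfolding Ksh_poly_def idom_hom.hom_Ksh[OF hom]
      by (rule Ksh_cong) (auto simp: e_def pcompose_pCons)
    also have "\<dots> = smult (x 0 ^ (3 * (n - 1) * (n - 2))) (Ksh_poly n (e 1))"
      by (subst Ksh_scale) (use n x0 in \<open>auto simp: Ksh_poly_def poly_const_pow\<close>)
    finally have "x 0 ^ (n * (n - 2)) * coeff (Ksh_poly n (e (x 0))) (n * (n - 2))
        = x 0 ^ (3 * (n - 1) * (n - 2)) * coeff (Ksh_poly n (e 1)) (n * (n - 2))"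
      by (metis coeff_pcompose_linear coeff_smult)
    moreover have "x 0 ^ (3 * (n - 1) * (n - 2)) = x 0 ^ (n * (n - 2)) * x 0 ^ ((n - 2) * (2 * n - 3))"
    proof -
      obtain m where "n = m + 2" using n by (metis add.commute le_iff_add)
      hence "3 * (n - 1) * (n - 2) = n * (n - 2) + (n - 2) * (2 * n - 3)" by (simp add: algebra_simps)
      thus ?thesis by (simp only: power_add)
    qed
    ultimately show ?thesis using x0 by simp
  qed
  also have "coeff (Ksh_poly n (e 1)) (n * (n - 2)) = poly (Ksh_poly n (e 1)) 1"
  proof -
    have "Ksh_poly n (\<lambda>j. monom (e 1 j) j) = map_poly (\<lambda>r. [:r:]) (Ksh_poly n (e 1))"
      unfolding map_const_Ksh_poly
      by (rule arg_cong[where f = "Ksh_poly n"]) (auto simp: e_def monom_0)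
    from coeff_eq_of_weighted_homogeneous(3)[OF w Ksh_poly_weighted(1)[OF n] this]
    show ?thesis by (metis mult.right_neutral poly_monom power_one)
  qed
  also have "\<dots> = Ksh n (\<lambda>j. if j = 0 \<or> j = n - 1 then 1 else 0)"
    unfolding poly_Ksh_poly[OF n1] by (rule Ksh_cong) (use n in \<open>auto simp: e_def\<close>)
  finally show ?thesis .
qed

section \<open>Nonvanishing of the two constants\<close>

lemma disc_eq_0_of_double_root:
  fixes c :: "nat \<Rightarrow> 'a::idom"
  assumes d: "d \<ge> 1" and c0: "c 0 \<noteq> 0"
    and root: "poly (dehom_form d c) \<zeta> = 0" "poly (pderiv (dehom_form d c)) \<zeta> = 0"
  shows "disc d c = 0"
proof -
  define F where "F = dehom_form d c"
  obtain h where h: "F = [:- \<zeta>, 1:] * h"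
    using root(1) by (auto simp: F_def poly_eq_0_iff_dvd)
  have "coeff F d \<noteq> 0" using c0 by (simp add: F_def coeff_dehom_form)
  hence "h \<noteq> 0" using h by auto
  have degF: "degree F \<le> d" by (rule degree_le) (simp add: F_def coeff_dehom_form)
  have "degree F = 1 + degree h" using \<open>h \<noteq> 0\<close> unfolding h by (subst degree_mult_eq) auto
  with degF have degh: "degree h \<le> d - 1" by simp
  have degF': "degree (pderiv F) \<le> d - 1"
    by (rule degree_le) (auto simp: F_def coeff_pderiv coeff_dehom_form)
  have "resultant_sub (Suc (d - 1)) (d - 1) F (pderiv F) = 0"
    using resultant_sub_linear_factor[OF degh degF', of \<zeta>] root(2)
    unfolding h[symmetric] by (simp add: F_def)
  hence "c 0 * disc d c = 0"
    using disc_resultant[OF d, of c] d by (simp add: F_def)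
  thus ?thesis using c0 by simp
qed

text \<open>The d distinct roots exhaust the degree, so \<open>p\<close> is a constant times a
  product of distinct linear factors, and no factor in the root formula of the discriminant
  vanishes.\<close>

lemma disc_neq_0_of_card_roots:
  fixes p :: "'a::field poly"
  assumes d: "d \<ge> 1" and deg: "degree p \<le> d" and lead: "coeff p d \<noteq> 0"
    and A: "finite A" "card A = d" "\<And>x. x \<in> A \<Longrightarrow> poly p x = 0"
  shows "disc d (\<lambda>i. coeff p (d - i)) \<noteq> 0"
proof -
  obtain \<delta> where \<delta>: "bij_betw \<delta> {..<d} A"
    using ex_bij_betw_nat_finite[OF A(1)] A(2) by (auto simp: lessThan_atLeast0)
  have inj: "\<delta> i \<noteq> \<delta> j" if "i < j" "j < d" for i j
    using \<delta> that by (auto simp: bij_betw_def inj_on_def)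
  define q where "q = (\<Prod>i<d. [:- \<delta> i, 1:])"
  have q: "degree q = d" unfolding q_def by (simp add: degree_prod_eq_sum_degree)
  have "lead_coeff q = (\<Prod>i<d. lead_coeff [:- \<delta> i, 1:])" unfolding q_def by (rule lead_coeff_prod)
  hence coeff_q: "coeff q d = 1" using q by simp
  define r where "r = p - smult (coeff p d) q"
  \<comment> \<open>The coefficients of degree d cancel, so a nonzero \<open>r\<close> would have
    degree below d and yet vanish at the d points of \<open>A\<close>.\<close>
  have "r = 0"
  proof (rule ccontr)
    assume "r \<noteq> 0"
    have "degree r \<le> d" unfolding r_def using deg q by (intro degree_diff_le) auto
    moreover have "coeff r d = 0" using coeff_q by (simp add: r_def)
    ultimately have "degree r < d"
      using \<open>r \<noteq> 0\<close> by (cases "degree r = d") (auto simp flip: leading_coeff_0_iff)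
    moreover have "A \<subseteq> {x. poly r x = 0}"
      using \<delta> A(3) by (auto simp: r_def q_def poly_prod bij_betw_def)
    hence "card A \<le> degree r"
      using card_mono[OF poly_roots_finite[OF \<open>r \<noteq> 0\<close>]] card_poly_roots_bound[OF \<open>r \<noteq> 0\<close>]
      by (blast intro: order_trans)
    ultimately show False using A(2) by simp
  qed
  hence p: "p = smult (coeff p d) q" by (simp add: r_def)
  have "dehom_form d (\<lambda>i. coeff p (d - i)) = p"
    using deg by (intro poly_eqI) (auto simp: coeff_dehom_form coeff_eq_0)
  also have "p = smult (coeff p (d - 0)) (\<Prod>i<d. [:- \<delta> i, 1:])"
    using p unfolding q_def by simp
  finally have "dehom_form d (\<lambda>i. coeff p (d - i)) = smult (coeff p (d - 0)) (\<Prod>i<d. [:- \<delta> i, 1:])" .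
  hence "disc d (\<lambda>i. coeff p (d - i)) = coeff p (d - 0) ^ (2 * d - 2) * (\<Prod>j<d. \<Prod>i<j. (\<delta> i - \<delta> j)\<^sup>2)"
    using d lead by (intro disc_dehom_roots) simp_all
  moreover have "(\<Prod>j<d. \<Prod>i<j. (\<delta> i - \<delta> j)\<^sup>2) \<noteq> 0" using inj by auto
  ultimately show ?thesis using lead by simp
qed

text \<open>X^n + 1 has n distinct complex roots, and the discriminant commutes with the embedding
  of the integers into the complex numbers.\<close>

lemma disc_binomial_neq_0:
  assumes n: "n \<ge> 1"
  shows "disc n (\<lambda>j. if j = 0 \<or> j = n then 1 else 0 :: int) \<noteq> 0"
proof -
  define p :: "complex poly" where "p = monom 1 n + 1"
  have coeff_p: "coeff p i = (if i = 0 \<or> i = n then 1 else 0)" for i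
    using n by (simp add: p_def)
  have "disc n (\<lambda>i. coeff p (n - i)) \<noteq> 0"
  proof (rule disc_neq_0_of_card_roots[OF n])
    show "degree p \<le> n" by (rule degree_le) (use coeff_p in auto)
    show "coeff p n \<noteq> 0" by (simp add: coeff_p)
    show "finite {z::complex. z ^ n = -1}" using n by (intro finite_nth_roots) auto
    show "card {z::complex. z ^ n = -1} = n" using n by (intro card_nth_roots) auto
  qed (auto simp: p_def poly_monom)
  also have "disc n (\<lambda>i. coeff p (n - i)) = disc n (\<lambda>j. of_int (if j = 0 \<or> j = n then 1 else 0))"
    by (rule disc_cong) (auto simp: coeff_p)
  also have "\<dots> = of_int (disc n (\<lambda>j. if j = 0 \<or> j = n then 1 else 0))"
    by (rule of_int_hom.hom_disc[symmetric])
  finally show ?thesis by simp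
qed

text \<open>The double root \<open>\<zeta>\<close> of \<open>X^n + X + t\<close> satisfies \<open>n \<zeta>^(n-1) = -1\<close>, and then
  \<open>t = - (1 - 1/n) \<zeta>\<close>; so the discriminant has \<open>n - 1\<close> simple roots \<open>t\<close>.\<close>

lemma Ksh_trinomial_neq_0:
  assumes n: "n \<ge> 2"
  shows "Ksh n (\<lambda>j. if j = 0 \<or> j = n - 1 then 1 else 0 :: int) \<noteq> 0"
proof -
  define x :: "nat \<Rightarrow> complex" where "x = (\<lambda>j. of_int (if j = 0 \<or> j = n - 1 then 1 else 0))"
  define p where "p = disc_poly n x"
  define Z where "Z = {z::complex. z ^ (n - 1) = - 1 / of_nat n}"
  define t where "t = (\<lambda>z::complex. - (1 - 1 / of_nat n) * z)"
  have x0: "x 0 = 1" by (simp add: x_def)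
  have "disc (n - 1) (\<lambda>i. coeff p (n - 1 - i)) \<noteq> 0"
  proof (rule disc_neq_0_of_card_roots)
    show "n - 1 \<ge> 1" using n by simp
    show "degree p \<le> n - 1" unfolding p_def by (rule degree_disc_poly) (use n in simp)
    \<comment> \<open>The coefficient of t^(n-1) is a power of \<open>x 0 = 1\<close> times the
      discriminant of X^n + 1, so \<open>p\<close> has exact degree n - 1.\<close>
    have "disc n (\<lambda>j. if j = 0 \<or> j = n then 1 else 0 :: complex)
        = disc n (\<lambda>j. of_int (if j = 0 \<or> j = n then 1 else 0))"
      by (rule disc_cong) auto
    also have "\<dots> = of_int (disc n (\<lambda>j. if j = 0 \<or> j = n then 1 else 0))"
      by (rule of_int_hom.hom_disc[symmetric])
    also have "\<dots> \<noteq> 0" using disc_binomial_neq_0[of n] n by simp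
    finally show "coeff p (n - 1) \<noteq> 0"
      unfolding p_def by (subst coeff_disc_poly_top) (use n x0 in auto)
    have "finite Z" unfolding Z_def by (rule finite_nth_roots) (use n in simp)
    moreover have "card Z = n - 1" unfolding Z_def by (rule card_nth_roots) (use n in simp_all)
    moreover have "inj t"
    proof -
      have "1 / of_nat n \<noteq> (1 :: complex)" using n by simp
      thus ?thesis by (auto simp: t_def inj_on_def)
    qed
    ultimately show "finite (t ` Z)" "card (t ` Z) = n - 1"
      by (simp_all add: card_image[OF inj_on_subset[OF _ subset_UNIV]])
  next
    fix \<tau> assume "\<tau> \<in> t ` Z"
    then obtain z where z: "z ^ (n - 1) = - 1 / of_nat n" "\<tau> = t z" by (auto simp: Z_def)
    have F: "dehom_form n (x(n := \<tau>)) = monom 1 n + monom 1 1 + [:\<tau>:]"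
    proof (rule poly_eqI)
      fix i
      consider "i = 0" | "i = 1" | "i = n" | "i \<noteq> 0" "i \<noteq> 1" "i \<noteq> n" by blast
      thus "coeff (dehom_form n (x(n := \<tau>))) i = coeff (monom 1 n + monom 1 1 + [:\<tau>:]) i"
      proof cases
        case 4
        hence "n - i \<noteq> n - 1" "n - i \<noteq> 0" "n - i \<noteq> n" if "i \<le> n" using that n by linarith+
        thus ?thesis using 4 by (simp add: coeff_dehom_form x_def coeff_eq_0)
      qed (use n in \<open>simp_all add: coeff_dehom_form x_def coeff_eq_0\<close>)
    qed
    have zn: "z ^ n = z * (- 1 / of_nat n)"
    proof -
      have "z ^ n = z * z ^ (n - 1)" using n by (cases n) auto
      thus ?thesis by (simp only: z(1))
    qed
    have "poly p \<tau> = disc n (x(n := \<tau>))" by (simp add: p_def poly_disc_poly)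
    also have "\<dots> = 0"
    proof (rule disc_eq_0_of_double_root)
      show "poly (dehom_form n (x(n := \<tau>))) z = 0"
        unfolding F by (simp add: poly_monom zn z(2) t_def algebra_simps)
      show "poly (pderiv (dehom_form n (x(n := \<tau>)))) z = 0"
        unfolding F using n by (simp add: pderiv_add pderiv_monom poly_monom pderiv_pCons z(1)[simplified])
    qed (use n x0 in auto)
    finally show "poly p \<tau> = 0" .
  qed
  also have "disc (n - 1) (\<lambda>i. coeff p (n - 1 - i)) = Ksh n x"
    by (simp add: p_def disc_poly_def Ksh_def)
  also have "\<dots> = of_int (Ksh n (\<lambda>j. if j = 0 \<or> j = n - 1 then 1 else 0))"
    unfolding x_def by (rule of_int_hom.hom_Ksh[symmetric])
  finally show ?thesis by simp
qed

section \<open>Zeros modulo large primes\<close>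

text \<open>Lagrange's bound for a formal degree and a nonzero reduction modulo \<open>p\<close>.
  Synthetic division by X - r stays within integer polynomials, and a quotient vanishing modulo
  \<open>p\<close> would force \<open>P\<close> to vanish modulo \<open>p\<close>.\<close>

lemma card_roots_mod_prime_le:
  fixes P :: "int poly" and p :: int
  assumes p: "prime p" and "degree P \<le> d" and "\<exists>i. \<not> p dvd coeff P i"
  shows "card {x \<in> {0..<p}. p dvd poly P x} \<le> d"
  using assms(2,3)
proof (induction d arbitrary: P)
  case 0
  then obtain c where c: "P = [:c:]" by (auto elim: degree_eq_zeroE)
  from 0 obtain i where "\<not> p dvd coeff P i" by blast
  hence "\<not> p dvd c" by (cases i) (simp_all add: c)
  thus ?case by (simp add: c)
next
  case (Suc d)
  show ?case
  proof (cases "{x \<in> {0..<p}. p dvd poly P x} = {}")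
    case False
    then obtain r where r: "r \<in> {0..<p}" "p dvd poly P r" by blast
    define Q where "Q = synthetic_div P r"
    have PQ: "P = [:poly P r:] + [:- r, 1:] * Q"
      using synthetic_div_correct'[of r P] by (simp add: Q_def add.commute)
    have degQ: "degree Q \<le> d" using Suc.prems by (simp add: Q_def degree_synthetic_div)
    have "\<exists>i. \<not> p dvd coeff Q i"
    proof (rule ccontr)
      assume "\<nexists>i. \<not> p dvd coeff Q i"
      hence "p dvd coeff P i" for i
        using r(2) by (subst PQ) (auto simp: coeff_pCons split: nat.split)
      thus False using Suc.prems by blast
    qed
    hence IH: "card {x \<in> {0..<p}. p dvd poly Q x} \<le> d" using Suc.IH degQ by blast
    have "{x \<in> {0..<p}. p dvd poly P x} \<subseteq> insert r {x \<in> {0..<p}. p dvd poly Q x}"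
    proof
      fix x assume x: "x \<in> {x \<in> {0..<p}. p dvd poly P x}"
      have "poly P x = poly P r + (x - r) * poly Q x" by (subst PQ) (simp add: algebra_simps)
      hence "p dvd (x - r) * poly Q x" using x r(2) by (simp add: dvd_add_right_iff)
      hence "p dvd x - r \<or> p dvd poly Q x" using p by (simp add: prime_dvd_mult_iff)
      moreover have "x = r" if "p dvd x - r"
      proof -
        have "\<bar>x - r\<bar> < p" using x r by auto
        thus ?thesis using that zdvd_imp_le[of p "\<bar>x - r\<bar>"] by force
      qed
      ultimately show "x \<in> insert r {x \<in> {0..<p}. p dvd poly Q x}" using x by auto
    qed
    moreover have fin: "finite {x \<in> {0..<p}. p dvd poly Q x}"
      by (rule finite_subset[of _ "{0..<p}"]) auto
    ultimately have "card {x \<in> {0..<p}. p dvd poly P x} \<le> card (insert r {x \<in> {0..<p}. p dvd poly Q x})"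
      by (intro card_mono) auto
    also have "\<dots> \<le> Suc (card {x \<in> {0..<p}. p dvd poly Q x})"
      using fin by (simp add: card_insert_if)
    finally show ?thesis using IH by simp
  qed (simp only: card.empty)
qed

section \<open>Primes dividing the leading coefficient\<close>

lemma dvd_poly_diff: "x - y dvd poly P x - poly P (y::int)"
proof -
  have "poly (P - [:poly P y:]) y = 0" by simp
  hence "[:- y, 1:] dvd P - [:poly P y:]" by (simp only: poly_eq_0_iff_dvd)
  then obtain Q where "P - [:poly P y:] = [:- y, 1:] * Q" ..
  hence "poly (P - [:poly P y:]) x = poly ([:- y, 1:] * Q) x" by (simp only:)
  hence "poly P x - poly P y = (x - y) * poly Q x" by (simp add: algebra_simps)
  thus ?thesis by simp
qed

text \<open>With c_0 = p h, the discriminant for leading coefficient y h is an integer polynomial in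
  y, whose values at y = p and y = 0 agree modulo p.\<close>

lemma disc_cong_mod_leading:
  fixes c :: "nat \<Rightarrow> int"
  assumes "p dvd c 0"
  shows "p dvd disc d c \<longleftrightarrow> p dvd disc d (c(0 := 0))"
proof -
  define h where "h = c 0 div p"
  define P where "P = disc d (\<lambda>i. if i = 0 then [:0, h:] else [:c i:])"
  have "poly P y = disc d (c(0 := y * h))" for y
    unfolding P_def poly_hom.hom_disc by (rule disc_cong) auto
  from this[of p] this[of 0] have "poly P p = disc d c" "poly P 0 = disc d (c(0 := 0))"
    using assms by (simp_all add: h_def)
  hence "p dvd disc d c - disc d (c(0 := 0))" using dvd_poly_diff[of p 0 P] by simp
  thus ?thesis by (metis diff_add_cancel dvd_add_right_iff)
qed

lemma Ksh_cong_mod_leading: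
  fixes c :: "nat \<Rightarrow> int"
  assumes "p dvd c 0"
  shows "p dvd Ksh d c \<longleftrightarrow> p dvd Ksh d (c(0 := 0))"
proof -
  define h where "h = c 0 div p"
  define P where "P = Ksh d (\<lambda>i. if i = 0 then [:0, h:] else [:c i:])"
  have "poly P y = Ksh d (c(0 := y * h))" for y
    unfolding P_def poly_hom.hom_Ksh by (rule Ksh_cong) auto
  from this[of p] this[of 0] have "poly P p = Ksh d c" "poly P 0 = Ksh d (c(0 := 0))"
    using assms by (simp_all add: h_def)
  hence "p dvd Ksh d c - Ksh d (c(0 := 0))" using dvd_poly_diff[of p 0 P] by simp
  thus ?thesis by (metis diff_add_cancel dvd_add_right_iff)
qed

lemma disc_poly_leading_zero:
  fixes x :: "nat \<Rightarrow> 'a::idom"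
  assumes n: "n \<ge> 2" and "x 0 = 0"
  shows "disc_poly n x = smult ((x 1)\<^sup>2) (disc_poly (n - 1) (\<lambda>i. x (Suc i)))"
proof -
  have "disc_poly n x = [:x 1:]\<^sup>2 * disc (n - 1) (\<lambda>i. if Suc i < n then [:x (Suc i):] else [:0, 1:])"
    unfolding disc_poly_def by (subst disc_leading_zero) (use assms in auto)
  also have "disc (n - 1) (\<lambda>i. if Suc i < n then [:x (Suc i):] else [:0, 1:]) = disc_poly (n - 1) (\<lambda>i. x (Suc i))"
    unfolding disc_poly_def by (rule disc_cong) (use n in auto)
  finally show ?thesis by (simp add: poly_const_pow)
qed

text \<open>The inner discriminant drops to degree n - 2 in X_n, so the outer one, of formal degree
  n - 1, has leading coefficient 0 too. \<open>disc_leading_zero\<close> then gives the square of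
  the next coefficient x_1^n \<open>\<alpha>\<close>, and the common factor x_1^2 is extracted from
  the remaining discriminant of degree n - 2.\<close>

lemma Ksh_leading_zero:
  fixes x :: "nat \<Rightarrow> 'a::idom"
  assumes n: "n \<ge> 3" and "x 0 = 0" "x 1 \<noteq> 0"
  shows "Ksh n x = x 1 ^ (6 * n - 12)
    * (disc (n - 1) (\<lambda>j. if j = 0 \<or> j = n - 1 then 1 else 0))\<^sup>2 * Ksh (n - 1) (\<lambda>i. x (Suc i))"
proof -
  define y where "y = (\<lambda>i. x (Suc i))"
  define \<alpha> where "\<alpha> = disc (n - 1) (\<lambda>j. if j = 0 \<or> j = n - 1 then 1 else (0::'a))"
  have Dx: "disc_poly n x = smult ((x 1)\<^sup>2) (disc_poly (n - 1) y)"
    unfolding y_def by (rule disc_poly_leading_zero) (use assms in auto)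
  have "degree (disc_poly (n - 1) y) \<le> n - 2"
    using degree_disc_poly[of "n - 1" y] n by (simp add: numeral_2_eq_2)
  hence zero: "coeff (disc_poly (n - 1) y) (n - 1) = 0" by (intro coeff_eq_0) (use n in simp)
  have lead: "coeff (disc_poly (n - 1) y) (n - 2) = x 1 ^ (n - 2) * \<alpha>"
    using coeff_disc_poly_top[of "n - 1" y] assms by (simp add: y_def \<alpha>_def numeral_2_eq_2)
  define f where "f = (\<lambda>i. coeff (disc_poly n x) (n - 1 - i))"
  have f: "f 0 = 0" "f 1 = (x 1)\<^sup>2 * (x 1 ^ (n - 2) * \<alpha>)"
    "f (Suc i) = (x 1)\<^sup>2 * 1 ^ i * coeff (disc_poly (n - 1) y) (n - 2 - i)" for i
  proof -
    have "n - 1 - 1 = n - 2" "n - 1 - Suc i = n - 2 - i" by simp_all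
    thus "f 0 = 0" "f 1 = (x 1)\<^sup>2 * (x 1 ^ (n - 2) * \<alpha>)"
      "f (Suc i) = (x 1)\<^sup>2 * 1 ^ i * coeff (disc_poly (n - 1) y) (n - 2 - i)"
      by (simp_all add: f_def Dx zero lead del: One_nat_def)
  qed
  have "Ksh n x = disc (n - 1) f"
    by (simp only: Ksh_def disc_poly_def f_def)
  also have "\<dots> = (f 1)\<^sup>2 * disc (n - 1 - 1) (\<lambda>i. f (Suc i))"
    by (rule disc_leading_zero) (use n f in auto)
  also have "n - 1 - 1 = n - 2" by simp
  also note f(2)
  also have "(\<lambda>i. f (Suc i)) = (\<lambda>i. (x 1)\<^sup>2 * 1 ^ i * coeff (disc_poly (n - 1) y) (n - 2 - i))"
    by (rule ext) (rule f(3))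
  also have "disc (n - 2) (\<lambda>i. (x 1)\<^sup>2 * 1 ^ i * coeff (disc_poly (n - 1) y) (n - 2 - i))
      = ((x 1)\<^sup>2) ^ (2 * (n - 2) - 2) * disc (n - 2) (\<lambda>i. coeff (disc_poly (n - 1) y) (n - 2 - i))"
    by (subst disc_scale) (use assms in auto)
  also have "disc (n - 2) (\<lambda>i. coeff (disc_poly (n - 1) y) (n - 2 - i)) = Ksh (n - 1) y"
    by (simp add: Ksh_def disc_poly_def numeral_2_eq_2)
  also have "((x 1)\<^sup>2 * (x 1 ^ (n - 2) * \<alpha>))\<^sup>2 * (((x 1)\<^sup>2) ^ (2 * (n - 2) - 2) * Ksh (n - 1) y)
      = x 1 ^ (6 * n - 12) * \<alpha>\<^sup>2 * Ksh (n - 1) y"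
  proof -
    have "6 * n - 12 = 2 * 2 + 2 * (n - 2) + 2 * (2 * (n - 2) - 2)" using n by simp
    hence "x 1 ^ (6 * n - 12) = ((x 1)\<^sup>2)\<^sup>2 * (x 1 ^ (n - 2))\<^sup>2 * ((x 1)\<^sup>2) ^ (2 * (n - 2) - 2)"
      by (simp only: power_add flip: power_mult) (simp only: mult.commute)
    thus ?thesis by (simp only: power_mult_distrib mult_ac)
  qed
  finally show ?thesis by (simp only: y_def \<alpha>_def)
qed

lemma degree_Ksh_poly: "n \<ge> 2 \<Longrightarrow> degree (Ksh_poly n x) \<le> n * (n - 2)"
  using coeff_eq_of_weighted_homogeneous(1)[OF _ Ksh_poly_weighted(1)] by simp

text \<open>\<open>\<alpha> n\<close> and \<open>\<kappa> n\<close> are the constants in the top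
  coefficients of D(s, .) and K. These coefficients are nonzero modulo \<open>p\<close>, so the root
  bound applies with degrees n - 1 and n(n - 2).\<close>

lemma card_residues_le:
  fixes n :: nat
  defines "\<alpha> \<equiv> \<lambda>n. disc n (\<lambda>j. if j = 0 \<or> j = n then 1 else 0 :: int)"
  defines "\<kappa> \<equiv> \<lambda>n. Ksh n (\<lambda>j. if j = 0 \<or> j = n - 1 then 1 else 0 :: int)"
  assumes p: "prime p" and n: "n \<ge> 2" and "\<not> p dvd \<alpha> n * \<kappa> n" and a: "\<not> p dvd a 0"
  shows "card {s \<in> {0..<p}. p dvd Ksh n (a(n - 1 := s))} \<le> n * n"
    and "card {t \<in> {0..<p}. p dvd disc n (a(n - 1 := s, n := t))} \<le> n"
proof -
  have a0: "a 0 \<noteq> 0" using a by auto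
  have ndvd: "\<not> p dvd a 0 ^ k" for k using a p prime_dvd_power by blast
  have "\<not> p dvd coeff (Ksh_poly n a) (n * (n - 2))"
    using assms a0 ndvd by (simp add: coeff_Ksh_poly_top prime_dvd_mult_iff)
  hence "card {s \<in> {0..<p}. p dvd poly (Ksh_poly n a) s} \<le> n * (n - 2)"
    by (intro card_roots_mod_prime_le p degree_Ksh_poly n) blast
  also have "\<dots> \<le> n * n" by simp
  finally show "card {s \<in> {0..<p}. p dvd Ksh n (a(n - 1 := s))} \<le> n * n"
    using n by (simp add: poly_Ksh_poly)
  define b where "b = a(n - 1 := s)"
  have b0: "b 0 = a 0" using n by (simp add: b_def)
  have "\<not> p dvd coeff (disc_poly n b) (n - 1)"
    using assms a0 b0 ndvd by (subst coeff_disc_poly_top) (auto simp: prime_dvd_mult_iff)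
  hence "card {t \<in> {0..<p}. p dvd poly (disc_poly n b) t} \<le> n - 1"
    using n by (intro card_roots_mod_prime_le p degree_disc_poly) auto
  thus "card {t \<in> {0..<p}. p dvd disc n (a(n - 1 := s, n := t))} \<le> n"
    by (simp add: poly_disc_poly b_def)
qed

lemma ex_card_residues_le:
  assumes n: "n \<ge> 3"
  shows "\<exists>Q::int. \<forall>p a. prime p \<longrightarrow> p > Q \<longrightarrow> \<not> p dvd gcd (a 0) (a 1) \<longrightarrow>
    card {s \<in> {0..<p}. p dvd Ksh n (a(n - 1 := s))} \<le> n * n \<and>
    (\<forall>s. card {t \<in> {0..<p}. p dvd disc n (a(n - 1 := s, n := t))} \<le> n)"
proof -
  define \<alpha> where "\<alpha> = (\<lambda>n. disc n (\<lambda>j. if j = 0 \<or> j = n then 1 else 0 :: int))"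
  define \<kappa> where "\<kappa> = (\<lambda>n. Ksh n (\<lambda>j. if j = 0 \<or> j = n - 1 then 1 else 0 :: int))"
  \<comment> \<open>Both degrees n and n - 1 are covered, the latter being used when p divides
    \<open>a 0\<close>.\<close>
  define Q where "Q = \<bar>\<alpha> n * \<kappa> n\<bar> + \<bar>\<alpha> (n - 1) * \<kappa> (n - 1)\<bar>"
  have nz: "\<alpha> k \<noteq> 0" "\<kappa> k \<noteq> 0" if "k \<ge> 2" for k
    using that disc_binomial_neq_0[of k] Ksh_trinomial_neq_0[of k] by (simp_all add: \<alpha>_def \<kappa>_def)
  have "card {s \<in> {0..<p}. p dvd Ksh n (a(n - 1 := s))} \<le> n * n \<and>
    (\<forall>s. card {t \<in> {0..<p}. p dvd disc n (a(n - 1 := s, n := t))} \<le> n)"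
    if p: "prime p" "p > Q" and a: "\<not> p dvd gcd (a 0) (a 1)" for p a
  proof -
    have ndvd: "\<not> p dvd \<alpha> k * \<kappa> k" if "k = n \<or> k = n - 1" for k
    proof
      assume "p dvd \<alpha> k * \<kappa> k"
      moreover have "\<alpha> k * \<kappa> k \<noteq> 0"
      proof -
        have "k \<ge> 2" using that n by auto
        thus ?thesis using nz[of k] by simp
      qed
      ultimately have "p \<le> \<bar>\<alpha> k * \<kappa> k\<bar>" using zdvd_imp_le[of p "\<bar>\<alpha> k * \<kappa> k\<bar>"] by simp
      also have "\<dots> \<le> Q" using that by (auto simp: Q_def)
      finally show False using p by simp
    qed
    show ?thesis
    proof (cases "p dvd a 0")
      case False
      thus ?thesis
        using card_residues_le[of p n a] p n ndvd[of n] unfolding \<alpha>_def \<kappa>_def by auto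
    next
      case True
      hence a1: "\<not> p dvd a 1" using a by simp
      have a1_power: "\<not> p dvd a 1 ^ k" for k using a1 p(1) prime_dvd_power by blast
      have \<alpha>_power: "\<not> p dvd \<alpha> (n - 1) ^ k" for k
        using ndvd[of "n - 1"] p(1) prime_dvd_power by (metis dvd_mult2)
      define y where "y = (\<lambda>i. a (Suc i))"
      \<comment> \<open>Modulo p, \<open>a 0\<close> may be replaced by 0. Then \<open>Ksh\<close>,
        and likewise the discriminant below, is a unit modulo p times its analogue for the form of
        degree n - 1 starting with \<open>a 1\<close>, so zeros modulo p persist.\<close>
      have K: "p dvd Ksh (n - 1) (y(n - 1 - 1 := s))" if "p dvd Ksh n (a(n - 1 := s))" for s
      proof -
        define x where "x = a(n - 1 := s, 0 := 0)"
        have x: "x 0 = 0" "x 1 = a 1" using n by (auto simp: x_def)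
        have "p dvd Ksh n x"
          using that Ksh_cong_mod_leading[of p "a(n - 1 := s)" n] True n by (simp add: x_def)
        also have "Ksh n x = x 1 ^ (6 * n - 12) * (\<alpha> (n - 1))\<^sup>2 * Ksh (n - 1) (\<lambda>i. x (Suc i))"
          unfolding \<alpha>_def by (rule Ksh_leading_zero) (use n x a1 in auto)
        finally have "p dvd Ksh (n - 1) (\<lambda>i. x (Suc i))"
          using p(1) a1_power \<alpha>_power unfolding x(2) by (simp only: prime_dvd_mult_iff) simp
        also have "Ksh (n - 1) (\<lambda>i. x (Suc i)) = Ksh (n - 1) (y(n - 1 - 1 := s))"
          by (rule Ksh_cong) (use n in \<open>auto simp: x_def y_def\<close>)
        finally show ?thesis .
      qed
      have D: "p dvd disc (n - 1) (y(n - 1 - 1 := s, n - 1 := t))" if "p dvd disc n (a(n - 1 := s, n := t))" for s t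
      proof -
        define x where "x = a(n - 1 := s, n := t, 0 := 0)"
        have x: "x 0 = 0" "x 1 = a 1" using n by (auto simp: x_def)
        have "p dvd disc n x"
          using that disc_cong_mod_leading[of p "a(n - 1 := s, n := t)" n] True n by (simp add: x_def)
        also have "disc n x = (x 1)\<^sup>2 * disc (n - 1) (\<lambda>i. x (Suc i))"
          by (rule disc_leading_zero) (use n x in auto)
        finally have "p dvd disc (n - 1) (\<lambda>i. x (Suc i))"
          using p(1) a1_power unfolding x(2) by (simp only: prime_dvd_mult_iff) simp
        also have "disc (n - 1) (\<lambda>i. x (Suc i)) = disc (n - 1) (y(n - 1 - 1 := s, n - 1 := t))"
          by (rule disc_cong) (use n in \<open>auto simp: x_def y_def\<close>)
        finally show ?thesis .
      qed
      have y0: "\<not> p dvd y 0" using a1 by (simp add: y_def)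
      have n': "n - 1 \<ge> 2" using n by simp
      have le: "card {s \<in> {0..<p}. p dvd Ksh (n - 1) (y(n - 1 - 1 := s))} \<le> (n - 1) * (n - 1)"
        "card {t \<in> {0..<p}. p dvd disc (n - 1) (y(n - 1 - 1 := s, n - 1 := t))} \<le> n - 1" for s
        using card_residues_le[of p "n - 1" y, OF p(1) n'] y0 ndvd[of "n - 1"] unfolding \<alpha>_def \<kappa>_def by blast+
      have fin: "finite {s \<in> {0..<p}. P s}" for P by (rule finite_subset[of _ "{0..<p}"]) auto
      have "card {s \<in> {0..<p}. p dvd Ksh n (a(n - 1 := s))} \<le> (n - 1) * (n - 1)"
        by (rule order_trans[OF card_mono[OF fin] le(1)]) (use K in auto)
      also have "\<dots> \<le> n * n" by (intro mult_le_mono) auto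
      finally have 1: "card {s \<in> {0..<p}. p dvd Ksh n (a(n - 1 := s))} \<le> n * n" .
      have "card {t \<in> {0..<p}. p dvd disc n (a(n - 1 := s, n := t))} \<le> n - 1" for s
        by (rule order_trans[OF card_mono[OF fin] le(2)[of s]]) (use D in auto)
      with 1 show ?thesis by (meson diff_le_self order_trans)
    qed
  qed
  thus ?thesis by blast
qed

section \<open>The size of \<open>Ksh\<close>\<close>

text \<open>\<open>Ksh\<close> nests a discriminant over integer polynomials in one over the
  integers. The interface lets one determinant estimate serve both, with the l1 norm of coefficients
  inside and the absolute value outside.\<close>

locale submultiplicative_norm =
  fixes nrm :: "'a::idom \<Rightarrow> int"
  assumes nrm_nonneg: "0 \<le> nrm x"
    and nrm_0: "nrm 0 = 0"
    and nrm_1: "nrm 1 \<le> 1"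
    and nrm_minus: "nrm (- x) = nrm x"
    and nrm_add: "nrm (x + y) \<le> nrm x + nrm y"
    and nrm_mult: "nrm (x * y) \<le> nrm x * nrm y"
begin

lemma nrm_sum: "nrm (sum f A) \<le> (\<Sum>a\<in>A. nrm (f a))"
proof (induction A rule: infinite_finite_induct)
  case (insert a A)
  thus ?case using nrm_add[of "f a" "sum f A"] by simp
qed (simp_all add: nrm_0)

lemma nrm_prod: "nrm (prod f A) \<le> (\<Prod>a\<in>A. nrm (f a))"
proof (induction A rule: infinite_finite_induct)
  case (insert a A)
  have "nrm (f a * prod f A) \<le> nrm (f a) * nrm (prod f A)" by (rule nrm_mult)
  also have "\<dots> \<le> nrm (f a) * (\<Prod>a\<in>A. nrm (f a))"
    by (intro mult_left_mono insert.IH nrm_nonneg)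
  finally show ?case using insert by simp
qed (simp_all add: nrm_1)

lemma nrm_of_nat: "nrm (of_nat k) \<le> int k"
proof (induction k)
  case (Suc k)
  thus ?case using nrm_add[of 1 "of_nat k"] nrm_1 by simp
qed (simp add: nrm_0)

lemma nrm_sign: "nrm (signof p * x) = nrm x"
  by (auto simp: sign_def nrm_minus)

lemma nrm_det_le:
  assumes A: "A \<in> carrier_mat N N" and B: "\<And>i j. i < N \<Longrightarrow> j < N \<Longrightarrow> nrm (A $$ (i, j)) \<le> B"
  shows "nrm (det A) \<le> fact N * B ^ N"
proof -
  have "nrm (det A) \<le> (\<Sum>p | p permutes {0..<N}. nrm (signof p * (\<Prod>i = 0..<N. A $$ (i, p i))))"
    unfolding det_def'[OF A] by (rule nrm_sum)
  also have "\<dots> \<le> (\<Sum>p | p permutes {0..<N}. B ^ N)"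
  proof (rule sum_mono)
    fix p assume "p \<in> {p. p permutes {0..<N}}"
    hence p: "p i < N" if "i < N" for i using that permutes_in_image[of p "{0..<N}" i] by auto
    have "nrm (signof p * (\<Prod>i = 0..<N. A $$ (i, p i))) \<le> (\<Prod>i = 0..<N. nrm (A $$ (i, p i)))"
      unfolding nrm_sign by (rule nrm_prod)
    also have "\<dots> \<le> (\<Prod>i = 0..<N. B)"
      by (rule prod_mono) (use B p nrm_nonneg in auto)
    finally show "nrm (signof p * (\<Prod>i = 0..<N. A $$ (i, p i))) \<le> B ^ N" by simp
  qed
  also have "\<dots> = fact N * B ^ N"
    by (simp add: card_permutations[OF refl])
  finally show ?thesis .
qed

text \<open>All entries of \<open>disc_mat\<close> have norm at most d H: differentiation multiplies
  the coefficients by at most d, and H \<ge> 1 covers the entries 1 and d of column 0.\<close>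

lemma nrm_disc_le:
  assumes d: "d \<ge> 1" and H: "H \<ge> 1" and c: "\<And>i. i \<le> d \<Longrightarrow> nrm (c i) \<le> H"
  shows "nrm (disc d c) \<le> fact (2 * d - 1) * (int d * H) ^ (2 * d - 1)"
proof -
  have le: "int k * h \<le> int d * H" if "k \<le> d" "h \<le> H" for k h
  proof -
    have "int k * h \<le> int k * H" using that by (intro mult_left_mono) auto
    also have "\<dots> \<le> int d * H" using that H by (intro mult_right_mono) auto
    finally show ?thesis .
  qed
  have pos: "0 \<le> int d * H" "1 \<le> int d * H" "int d \<le> int d * H"
    using le[of 0 1] le[of 1 1] le[of d 1] d H by auto
  have F: "nrm (coeff (dehom_form d c) k) \<le> int d * H" for k
    using c[of "d - k"] le[of 1 "nrm (c (d - k))"] d pos by (simp add: coeff_dehom_form nrm_0)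
  have F': "nrm (coeff (pderiv (dehom_form d c)) k) \<le> int d * H" for k
  proof (cases "Suc k \<le> d")
    case True
    have "nrm (of_nat (Suc k) * c (d - Suc k)) \<le> nrm (of_nat (Suc k)) * nrm (c (d - Suc k))"
      by (rule nrm_mult)
    also have "\<dots> \<le> int (Suc k) * nrm (c (d - Suc k))"
      by (intro mult_right_mono nrm_of_nat nrm_nonneg)
    also have "\<dots> \<le> int d * H" by (rule le) (use True c in auto)
    finally show ?thesis using True by (simp add: coeff_pderiv coeff_dehom_form del: of_nat_Suc)
  qed (use pos in \<open>simp add: coeff_pderiv coeff_dehom_form nrm_0 del: of_nat_Suc\<close>)
  have 1: "nrm 1 \<le> int d * H" using nrm_1 pos by linarith
  have dd: "nrm (of_nat d) \<le> int d * H" using nrm_of_nat[of d] pos by linarith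
  have "nrm (disc_mat d c $$ (i, j)) \<le> int d * H" if "i < 2 * d - 1" "j < 2 * d - 1" for i j
  proof -
    have "i < d + (d - 1)" "j < d + (d - 1)" using that by auto
    hence "nrm (sylvester_mat_sub d (d - 1) (dehom_form d c) (pderiv (dehom_form d c)) $$ (i, j)) \<le> int d * H"
      using F F' pos by (simp add: sylvester_mat_sub_index nrm_0)
    thus ?thesis using that 1 dd pos by (simp add: disc_mat_def nrm_0)
  qed
  hence "nrm (det (disc_mat d c)) \<le> fact (2 * d - 1) * (int d * H) ^ (2 * d - 1)"
    by (rule nrm_det_le[OF disc_mat_carrier])
  thus ?thesis
    by (cases "even (d choose 2)") (simp_all add: disc_def nrm_minus)
qed

end

interpretation abs_int: submultiplicative_norm "\<lambda>x::int. \<bar>x\<bar>"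
  by unfold_locales (auto simp: abs_mult)

text \<open>Written as a value at 1, the l1 norm reduces its triangle inequality and
  submultiplicativity to coefficientwise comparison and the rules for evaluation.\<close>

definition l1_int :: "int poly \<Rightarrow> int" where
  "l1_int p = poly (map_poly abs p) 1"

lemma poly_1_eq_sum: "degree (p :: int poly) \<le> N \<Longrightarrow> poly p 1 = (\<Sum>i\<le>N. coeff p i)"
  by (subst poly_as_sum_of_monoms'[symmetric, of p N]) (simp_all add: poly_sum poly_monom)

lemma l1_int_le:
  assumes "\<And>i. \<bar>coeff p i\<bar> \<le> coeff q i"
  shows "l1_int p \<le> poly q 1"
proof -
  define N where "N = max (degree p) (degree q)"
  have "degree (map_poly abs p) \<le> N"
    unfolding N_def by (intro degree_le) (auto simp: coeff_map_poly coeff_eq_0)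
  thus ?thesis using assms
    by (simp add: l1_int_def poly_1_eq_sum[of _ N] N_def coeff_map_poly sum_mono)
qed

lemma abs_coeff_le_l1_int: "\<bar>coeff p i\<bar> \<le> l1_int p"
proof -
  have "degree (map_poly abs p) \<le> max i (degree p)"
    by (intro degree_le) (auto simp: coeff_map_poly coeff_eq_0)
  hence "l1_int p = (\<Sum>j\<le>max i (degree p). \<bar>coeff p j\<bar>)"
    by (simp add: l1_int_def poly_1_eq_sum coeff_map_poly)
  moreover have "\<bar>coeff p i\<bar> \<le> (\<Sum>j\<le>max i (degree p). \<bar>coeff p j\<bar>)"
    by (rule member_le_sum) auto
  ultimately show ?thesis by simp
qed

interpretation l1_int: submultiplicative_norm l1_int
proof
  fix p q :: "int poly"
  show "0 \<le> l1_int p" using abs_coeff_le_l1_int[of p 0] by linarith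
  show "l1_int 0 = 0" "l1_int 1 \<le> 1" by (simp_all add: l1_int_def)
  have "map_poly abs (- p) = map_poly abs p" by (rule poly_eqI) (simp add: coeff_map_poly)
  thus "l1_int (- p) = l1_int p" by (simp add: l1_int_def)
  have "l1_int (p + q) \<le> poly (map_poly abs p + map_poly abs q) 1"
    by (rule l1_int_le) (simp add: coeff_map_poly abs_triangle_ineq)
  thus "l1_int (p + q) \<le> l1_int p + l1_int q" by (simp add: l1_int_def)
  have "l1_int (p * q) \<le> poly (map_poly abs p * map_poly abs q) 1"
  proof (rule l1_int_le)
    fix i
    show "\<bar>coeff (p * q) i\<bar> \<le> coeff (map_poly abs p * map_poly abs q) i"
      unfolding coeff_mult
      by (rule order_trans[OF sum_abs]) (simp add: coeff_map_poly abs_mult)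
  qed
  thus "l1_int (p * q) \<le> l1_int p * l1_int q" by (simp add: l1_int_def)
qed

text \<open>Polynomial growth of \<open>Ksh\<close>, which later bounds ln |K(s)| by a multiple of
  T. The norm estimate is applied to the inner discriminant, whose coefficients are the arguments of
  the outer one.\<close>

lemma abs_Ksh_le:
  assumes n: "n \<ge> 2"
  shows "\<exists>(K::int) (E::nat). K \<ge> 1 \<and>
    (\<forall>x H. H \<ge> 1 \<longrightarrow> (\<forall>i<n. \<bar>x i\<bar> \<le> H) \<longrightarrow> \<bar>Ksh n x\<bar> \<le> K * H ^ E)"
proof -
  define k where "k = 2 * n - 1"
  define m where "m = 2 * (n - 1) - 1"
  define L where "L = fact k * int n ^ k"
  have "L > 0" using n by (simp add: L_def)
  hence L: "L \<ge> 1" by simp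
  define K where "K = fact m * (int (n - 1) * L) ^ m"
  have bound: "\<bar>Ksh n x\<bar> \<le> K * H ^ (k * m)"
    if H: "H \<ge> 1" and x: "\<And>i. i < n \<Longrightarrow> \<bar>x i\<bar> \<le> H" for x H
  proof -
    define c where "c = (\<lambda>j. if j < n then [:x j:] else [:0, 1:])"
    have "l1_int (c i) \<le> H" for i
    proof -
      have "l1_int [:x i:] \<le> poly [:\<bar>x i\<bar>:] 1"
        by (rule l1_int_le) (simp add: coeff_pCons split: nat.split)
      moreover have "l1_int [:0, 1:] \<le> poly [:0, 1:] 1"
        by (rule l1_int_le) (simp add: coeff_pCons split: nat.split)
      ultimately show ?thesis using x[of i] H by (auto simp: c_def)
    qed
    hence "l1_int (disc n c) \<le> fact k * (int n * H) ^ k"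
      unfolding k_def by (intro l1_int.nrm_disc_le) (use n H in auto)
    also have "\<dots> = L * H ^ k" by (simp add: L_def power_mult_distrib)
    finally have l1: "l1_int (disc n c) \<le> L * H ^ k" .
    have "L * H ^ k > 0" using L H by simp
    hence "L * H ^ k \<ge> 1" by simp
    hence "\<bar>Ksh n x\<bar> \<le> fact m * (int (n - 1) * (L * H ^ k)) ^ m"
      unfolding Ksh_def m_def c_def[symmetric]
      by (intro abs_int.nrm_disc_le order_trans[OF abs_coeff_le_l1_int l1]) (use n in auto)
    also have "\<dots> = K * H ^ (k * m)" by (simp add: K_def power_mult_distrib power_mult mult_ac)
    finally show ?thesis .
  qed
  have "K > 0" using n L by (simp add: K_def)
  hence "K \<ge> 1" by simp
  thus ?thesis using bound by blast
qed

section \<open>Prime divisors and sums over primes\<close>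

lemma prod_primes_dvd:
  fixes N :: nat
  assumes "finite P" "\<And>p. p \<in> P \<Longrightarrow> prime p" "\<And>p. p \<in> P \<Longrightarrow> p dvd N"
  shows "\<Prod>P dvd N"
  using assms
proof (induction P rule: finite_induct)
  case (insert p P)
  have "coprime p (\<Prod>P)"
    by (rule prod_coprime_right) (use insert in \<open>auto intro: primes_coprime\<close>)
  thus ?case using insert by (auto intro: divides_mult)
qed simp

text \<open>\<open>x ^ k / fact k\<close> is one term of the exponential series.\<close>

lemma fact_ge_power_exp:
  fixes x :: real
  assumes "x \<ge> 0"
  shows "x ^ k \<le> exp x * fact k"
proof -
  have "x ^ k / fact k = (\<Sum>i\<in>{k}. x ^ i /\<^sub>R fact i)" by (simp add: field_simps)
  also have "\<dots> \<le> (\<Sum>i. x ^ i /\<^sub>R fact i)"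
    by (rule sum_le_suminf[OF summable_exp_generic]) (use assms in auto)
  also have "\<dots> = exp x" by (simp add: exp_def)
  finally show ?thesis by (simp add: field_simps)
qed

text \<open>The largest of k distinct positive integers is at least k; removing it gives the
  induction.\<close>

lemma fact_card_le_prod:
  fixes P :: "nat set"
  assumes "finite P" "0 \<notin> P"
  shows "fact (card P) \<le> \<Prod>P"
  using assms
proof (induction "card P" arbitrary: P)
  case (Suc k)
  define m where "m = Max P"
  have "P \<noteq> {}" using Suc(2) by auto
  hence P: "P \<noteq> {}" "m \<in> P" using Suc.prems by (auto simp: m_def)
  have "P \<subseteq> {1..m}" using Suc.prems by (auto simp: m_def Suc_le_eq intro!: Nat.gr0I)
  hence "card P \<le> m" using card_mono[of "{1..m}" P] by simp
  moreover have "fact (card (P - {m})) \<le> \<Prod>(P - {m})"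
    by (rule Suc.hyps(1)) (use Suc P in auto)
  ultimately have "card P * fact (card P - 1) \<le> m * \<Prod>(P - {m})"
    using Suc P by (intro mult_mono) auto
  moreover have "fact (card P) = card P * fact (card P - 1)"
    using Suc(2) by (subst fact_reduce) auto
  ultimately show ?case using Suc P by (simp add: prod.remove)
qed simp

text \<open>With \<open>k = card P\<close>, bound \<open>k ln L\<close> by \<open>L^k \<le> N\<close> and \<open>k ln T\<close> by
  \<open>T^k e^-T \<le> k! \<le> N\<close>.\<close>

lemma card_large_prime_divisors_le:
  fixes P :: "nat set" and N :: nat and L T c :: real
  assumes P: "finite P" "\<And>p. p \<in> P \<Longrightarrow> prime p" "\<And>p. p \<in> P \<Longrightarrow> p dvd N"
    "\<And>p. p \<in> P \<Longrightarrow> real p \<ge> L"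
    and "N > 0" "L \<ge> 1" "T > 0" "c \<ge> 0" and N: "ln (real N) \<le> c * T"
  shows "real (card P) * (ln L + ln T) \<le> (2 * c + 1) * T"
proof -
  have le: "\<Prod>P \<le> N" using prod_primes_dvd[OF P(1-3)] \<open>N > 0\<close> by (auto dest: dvd_imp_le)
  have "L ^ card P = (\<Prod>p\<in>P. L)" by simp
  also have "\<dots> \<le> (\<Prod>p\<in>P. real p)" by (rule prod_mono) (use assms in auto)
  also have "\<dots> \<le> real N" using le by (simp flip: of_nat_prod)
  finally have "ln (L ^ card P) \<le> ln (real N)" using assms by (subst ln_le_cancel_iff) auto
  hence 1: "real (card P) * ln L \<le> c * T" using assms by (simp add: ln_realpow)
  have "0 \<notin> P" using P(2) by fastforce
  have "T ^ card P \<le> exp T * fact (card P)" by (rule fact_ge_power_exp) (use assms in simp)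
  also have "\<dots> \<le> exp T * real N"
  proof (rule mult_left_mono)
    have "fact (card P) \<le> N" using fact_card_le_prod[OF P(1) \<open>0 \<notin> P\<close>] le by (rule order_trans)
    hence "real (fact (card P)) \<le> real N" by (simp only: of_nat_le_iff)
    thus "fact (card P) \<le> real N" by (simp only: of_nat_fact)
  qed simp
  finally have "ln (T ^ card P) \<le> ln (exp T * real N)" using assms by (subst ln_le_cancel_iff) auto
  also have "\<dots> = T + ln (real N)" using assms by (simp add: ln_mult)
  finally have 2: "real (card P) * ln T \<le> T + c * T" using assms N by (simp add: ln_realpow)
  from 1 2 show ?thesis by (simp add: algebra_simps)
qed

text \<open>Chebyshev's argument: the primes in (N, 2N] all divide the central binomial coefficient,
  which is at most 4^N.\<close>

lemma card_primes_dyadic_le: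
  fixes N :: nat
  assumes "N \<ge> 2"
  shows "real (card {p. prime p \<and> N < p \<and> p \<le> 2 * N}) * ln (real N) \<le> 2 * ln 2 * real N"
proof -
  define P where "P = {p. prime p \<and> N < p \<and> p \<le> 2 * N}"
  have fin: "finite P" by (rule finite_subset[of _ "{..2 * N}"]) (auto simp: P_def)
  have "p dvd (2 * N choose N)" if p: "p \<in> P" for p
  proof -
    have "p dvd fact (2 * N)" using p by (auto simp: P_def prime_dvd_fact_iff)
    also have "fact (2 * N) = fact N * fact N * (2 * N choose N)"
      using binomial_fact_lemma[of N "2 * N"] by simp
    finally show ?thesis
      using p by (auto simp: P_def prime_dvd_mult_iff prime_dvd_fact_iff)
  qed
  hence "\<Prod>P dvd (2 * N choose N)" by (intro prod_primes_dvd fin) (auto simp: P_def)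
  hence "\<Prod>P \<le> (2 * N choose N)" by (rule dvd_imp_le) (simp add: zero_less_binomial)
  also have "\<dots> \<le> 2 ^ (2 * N)" by (rule binomial_le_pow2)
  finally have le: "\<Prod>P \<le> 2 ^ (2 * N)" .
  have "real N ^ card P = (\<Prod>p\<in>P. real N)" by simp
  also have "\<dots> \<le> (\<Prod>p\<in>P. real p)" by (rule prod_mono) (auto simp: P_def)
  also have "\<dots> = real (\<Prod>P)" by simp
  also have "\<dots> \<le> real (2 ^ (2 * N))" using le by (subst of_nat_le_iff)
  finally have *: "ln (real N ^ card P) \<le> ln (2 ^ (2 * N))" using assms by (subst ln_le_cancel_iff) auto
  have "real (card P) * ln (real N) = ln (real N ^ card P)"
    using assms by (simp add: ln_realpow)
  also note *
  also have "ln (2 ^ (2 * N)) = 2 * ln 2 * real N"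
    by (subst ln_realpow) simp_all
  finally show ?thesis by (simp only: P_def)
qed

text \<open>The range is cut into dyadic blocks starting at 2^j N. Bounding ln(2^j N) below by ln N
  makes the block bounds a geometric series of ratio 1/2, whose sum is at most twice its first
  term.\<close>

lemma sum_primes_inverse_square_le:
  fixes N K :: nat
  assumes N: "N \<ge> 2"
  shows "(\<Sum>p | prime p \<and> N < p \<and> p \<le> K. 1 / (real p)\<^sup>2) \<le> 4 * ln 2 / (real N * ln (real N))"
proof -
  define P where "P = (\<lambda>j. {p. prime p \<and> 2 ^ j * N < p \<and> p \<le> 2 * (2 ^ j * N)})"
  have fin: "finite (P j)" for j by (rule finite_subset[of _ "{..2 * (2 ^ j * N)}"]) (auto simp: P_def)
  have block: "(\<Sum>p\<in>P j. 1 / (real p)\<^sup>2) \<le> 2 * ln 2 / (real N * ln (real N)) * (1/2) ^ j" for j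
  proof -
    define X where "X = 2 ^ j * N"
    have "N \<le> X" by (simp add: X_def)
    have X: "X \<ge> 2" using N \<open>N \<le> X\<close> by simp
    have lnN: "ln (real N) > 0" using N by simp
    have lnX: "ln (real N) \<le> ln (real X)" using N \<open>N \<le> X\<close> by simp
    have "(\<Sum>p\<in>P j. 1 / (real p)\<^sup>2) \<le> (\<Sum>p\<in>P j. 1 / (real X)\<^sup>2)"
    proof (intro sum_mono frac_le power_mono)
      fix p assume "p \<in> P j"
      hence "X < p" by (simp add: P_def X_def)
      thus "real X \<le> real p" by simp
    qed (use X in auto)
    also have "\<dots> = real (card (P j)) / (real X)\<^sup>2" by simp
    also have "\<dots> \<le> (2 * ln 2 * real X / ln (real N)) / (real X)\<^sup>2"
    proof (rule divide_right_mono)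
      have "real (card (P j)) * ln (real N) \<le> real (card (P j)) * ln (real X)"
        by (intro mult_left_mono lnX) simp
      also have "\<dots> \<le> 2 * ln 2 * real X"
        using card_primes_dyadic_le[OF X] by (simp add: P_def X_def)
      finally show "real (card (P j)) \<le> 2 * ln 2 * real X / ln (real N)"
        using lnN by (simp add: field_simps)
    qed simp
    also have "\<dots> = 2 * ln 2 / (real N * ln (real N)) * (1/2) ^ j"
      using N lnN by (simp add: X_def field_simps power2_eq_square)
    finally show ?thesis .
  qed
  have cover: "{p. prime p \<and> N < p \<and> p \<le> 2 ^ J * N} = (\<Union>j<J. P j)" for J
  proof (induction J)
    case (Suc J)
    have "{p. prime p \<and> N < p \<and> p \<le> 2 ^ Suc J * N} = {p. prime p \<and> N < p \<and> p \<le> 2 ^ J * N} \<union> P J"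
    proof -
      have *: "N < x" if "2 ^ J * N < x" for x
        using that by (rule le_less_trans[rotated]) simp
      show ?thesis unfolding P_def by (auto intro: *)
    qed
    thus ?case by (simp add: Suc.IH lessThan_Suc Un_commute)
  qed auto
  \<comment> \<open>Hence \<open>K\<close> blocks are enough to cover all primes up to
    \<open>K\<close>.\<close>
  have "K < 2 ^ K" by (rule less_exp)
  also have "\<dots> \<le> 2 ^ K * N" using N by simp
  finally have K: "K \<le> 2 ^ K * N" by simp
  have "(\<Sum>p | prime p \<and> N < p \<and> p \<le> K. 1 / (real p)\<^sup>2) \<le> (\<Sum>p\<in>(\<Union>j<K. P j). 1 / (real p)\<^sup>2)"
  proof (rule sum_mono2)
    show "{p. prime p \<and> N < p \<and> p \<le> K} \<subseteq> (\<Union>j<K. P j)"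
      unfolding cover[symmetric] using K by (blast intro: order_trans)
  qed (use fin in auto)
  also have "\<dots> \<le> (\<Sum>j<K. \<Sum>p\<in>P j. 1 / (real p)\<^sup>2)"
  proof (induction K)
    case (Suc J)
    have "(\<Sum>p\<in>(\<Union>j<J. P j) \<union> P J. 1 / (real p)\<^sup>2) + (\<Sum>p\<in>(\<Union>j<J. P j) \<inter> P J. 1 / (real p)\<^sup>2)
      = (\<Sum>p\<in>(\<Union>j<J. P j). 1 / (real p)\<^sup>2) + (\<Sum>p\<in>P J. 1 / (real p)\<^sup>2)"
      by (rule sum.union_inter) (use fin in auto)
    moreover have "(\<Sum>p\<in>(\<Union>j<J. P j) \<inter> P J. 1 / (real p)\<^sup>2) \<ge> 0"
      by (rule sum_nonneg) simp
    ultimately show ?case using Suc.IH by (simp add: lessThan_Suc Un_commute)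
  qed simp
  also have "\<dots> \<le> (\<Sum>j<K. 2 * ln 2 / (real N * ln (real N)) * (1/2) ^ j)"
    by (rule sum_mono) (rule block)
  also have "\<dots> = 2 * ln 2 / (real N * ln (real N)) * (\<Sum>j<K. (1/2) ^ j)"
    by (simp add: sum_distrib_left)
  also have "\<dots> \<le> 2 * ln 2 / (real N * ln (real N)) * 2"
  proof (rule mult_left_mono)
    have "(\<Sum>j<K. (1/2::real) ^ j) = 2 - 2 * (1/2) ^ K" by (induction K) auto
    thus "(\<Sum>j<K. (1/2::real) ^ j) \<le> 2" by simp
  qed (use N in simp)
  finally show ?thesis by simp
qed

section \<open>Counting pairs in residue classes\<close>

lemma finite_abs_le_int: "finite {x::int. \<bar>real_of_int x\<bar> \<le> X}"
proof (rule finite_subset)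
  show "{x::int. \<bar>real_of_int x\<bar> \<le> X} \<subseteq> {- \<lfloor>X\<rfloor>..\<lfloor>X\<rfloor>}"
    by (auto simp: abs_le_iff le_floor_iff) linarith
qed simp

text \<open>Counted from the least element in steps of \<open>q\<close>, the elements of
  \<open>S\<close> get distinct indices between 0 and 2X/q.\<close>

lemma card_residue_class_le:
  fixes S :: "int set" and q :: int
  assumes q: "q > 0" and X: "X \<ge> 0" and S: "\<And>x. x \<in> S \<Longrightarrow> \<bar>real_of_int x\<bar> \<le> X"
    and cong: "\<And>x y. x \<in> S \<Longrightarrow> y \<in> S \<Longrightarrow> q dvd x - y"
  shows "real (card S) \<le> 2 * X / real_of_int q + 1"
proof (cases "S = {}")
  case False
  have fin: "finite S" by (rule finite_subset[OF _ finite_abs_le_int[of X]]) (use S in auto)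
  define a where "a = Min S"
  have a: "a \<in> S" "\<And>x. x \<in> S \<Longrightarrow> a \<le> x" using fin False by (auto simp: a_def)
  define f where "f = (\<lambda>x. (x - a) div q)"
  have f: "q * f x = x - a" if "x \<in> S" for x
    using cong[OF that a(1)] by (simp add: f_def)
  have "inj_on f S"
  proof (rule inj_onI)
    fix x y assume "x \<in> S" "y \<in> S" "f x = f y"
    hence "x - a = y - a" by (metis f)
    thus "x = y" by simp
  qed
  moreover have "f ` S \<subseteq> {0..\<lfloor>2 * X / real_of_int q\<rfloor>}"
  proof safe
    fix x assume x: "x \<in> S"
    show "f x \<in> {0..\<lfloor>2 * X / real_of_int q\<rfloor>}"
    proof -
      have "0 \<le> f x" using a(2)[OF x] q by (simp add: f_def pos_imp_zdiv_nonneg_iff)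
      moreover have "real_of_int q * real_of_int (f x) = real_of_int x - real_of_int a"
        by (simp only: f[OF x] flip: of_int_mult of_int_diff)
      hence "real_of_int (f x) * real_of_int q \<le> 2 * X"
        using S[OF x] S[OF a(1)] by (simp add: mult.commute)
      hence "real_of_int (f x) \<le> 2 * X / real_of_int q" using q by (simp add: pos_le_divide_eq)
      ultimately show ?thesis by (simp add: le_floor_iff)
    qed
  qed
  ultimately have "card S \<le> card {0..\<lfloor>2 * X / real_of_int q\<rfloor>}"
    by (intro card_inj_on_le) auto
  also have "\<dots> = nat (\<lfloor>2 * X / real_of_int q\<rfloor> + 1)" by simp
  finally have "real (card S) \<le> real (nat (\<lfloor>2 * X / real_of_int q\<rfloor> + 1))" by simp
  also have "\<dots> = real_of_int \<lfloor>2 * X / real_of_int q\<rfloor> + 1"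
    using q X by simp
  also have "\<dots> \<le> 2 * X / real_of_int q + 1" by simp
  finally show ?thesis .
qed (use assms in simp)

text \<open>By coprimality, the elements of \<open>S\<close> with a fixed residue modulo
  \<open>p\<close> lie in one class modulo \<open>q * p\<close>; at most \<open>d\<close> residues
  occur.\<close>

lemma card_residue_classes_le:
  fixes S Z :: "int set" and q p :: int
  assumes q: "q > 0" and p: "p > 0" "coprime q p"
    and X: "X \<ge> 0" and S: "\<And>x. x \<in> S \<Longrightarrow> \<bar>real_of_int x\<bar> \<le> X"
    and cong: "\<And>x y. x \<in> S \<Longrightarrow> y \<in> S \<Longrightarrow> q dvd x - y"
    and Z: "finite Z" "\<And>x. x \<in> S \<Longrightarrow> x mod p \<in> Z" "card Z \<le> d"
  shows "real (card S) \<le> real d * (2 * X / (real_of_int q * real_of_int p) + 1)"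
proof -
  define F where "F = (\<lambda>z. {x \<in> S. x mod p = z})"
  have F: "real (card (F z)) \<le> 2 * X / (real_of_int q * real_of_int p) + 1" for z
  proof -
    have "q * p dvd x - y" if "x \<in> F z" "y \<in> F z" for x y
    proof (rule divides_mult)
      show "p dvd x - y" using that by (simp add: F_def flip: mod_eq_dvd_iff)
    qed (use that cong p(2) in \<open>auto simp: F_def\<close>)
    hence "real (card (F z)) \<le> 2 * X / real_of_int (q * p) + 1"
      by (intro card_residue_class_le) (use q p X S in \<open>auto simp: F_def\<close>)
    thus ?thesis by simp
  qed
  have "S = (\<Union>z\<in>Z. F z)" using Z by (auto simp: F_def)
  hence "card S \<le> (\<Sum>z\<in>Z. card (F z))" using card_UN_le[OF Z(1), of F] by simp
  hence "real (card S) \<le> (\<Sum>z\<in>Z. real (card (F z)))" by (simp flip: of_nat_sum)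
  also have "\<dots> \<le> (\<Sum>z\<in>Z. 2 * X / (real_of_int q * real_of_int p) + 1)" by (rule sum_mono) (rule F)
  also have "\<dots> = real (card Z) * (2 * X / (real_of_int q * real_of_int p) + 1)" by simp
  also have "\<dots> \<le> real d * (2 * X / (real_of_int q * real_of_int p) + 1)"
    using Z(3) q p X by (intro mult_right_mono) auto
  finally show ?thesis .
qed

lemma card_fibers_le:
  assumes fin: "finite G" and fib: "\<And>s. real (card {t. (s, t) \<in> G}) \<le> b"
  shows "real (card G) \<le> real (card (fst ` G)) * b"
proof -
  have fin': "finite {t. (s, t) \<in> G}" for s
  proof (rule finite_subset)
    show "{t. (s, t) \<in> G} \<subseteq> snd ` G" by force
  qed (use fin in simp)
  have "Sigma (fst ` G) (\<lambda>s. {t. (s, t) \<in> G}) = G" by force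
  moreover have "card (Sigma (fst ` G) (\<lambda>s. {t. (s, t) \<in> G})) = (\<Sum>s\<in>fst ` G. card {t. (s, t) \<in> G})"
    by (rule card_SigmaI) (use fin fin' in auto)
  ultimately have "card G = (\<Sum>s\<in>fst ` G. card {t. (s, t) \<in> G})" by (simp only:)
  hence "real (card G) = (\<Sum>s\<in>fst ` G. real (card {t. (s, t) \<in> G}))" by simp
  also have "\<dots> \<le> (\<Sum>s\<in>fst ` G. b)" by (rule sum_mono) (rule fib)
  finally show ?thesis by simp
qed

text \<open>The facts on which the counting rests. In the application \<open>G\<close> consists of
  the pairs in the box satisfying both divisibility conditions at l, and \<open>K\<close>,
  \<open>D\<close> are \<open>Ksh\<close> and \<open>disc\<close> as functions of s and t.\<close>

locale congruence_sieve =
  fixes G :: "(int \<times> int) set" and m :: int and A B :: real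
    and K :: "int \<Rightarrow> int" and D :: "int \<Rightarrow> int \<Rightarrow> int" and d :: nat
  assumes m: "m \<ge> 1" and A: "A > 0" and B: "B > 0"
    and bounded: "\<And>s t. (s, t) \<in> G \<Longrightarrow> \<bar>real_of_int s\<bar> \<le> A \<and> \<bar>real_of_int t\<bar> \<le> B"
    and cong_s: "\<And>s t s' t'. (s, t) \<in> G \<Longrightarrow> (s', t') \<in> G \<Longrightarrow> m dvd s - s'"
    and cong_t: "\<And>s t t'. (s, t) \<in> G \<Longrightarrow> (s, t') \<in> G \<Longrightarrow> m\<^sup>2 dvd t - t'"
    and K_mod: "\<And>p s. p dvd K s \<longleftrightarrow> p dvd K (s mod p)"
    and D_mod: "\<And>p s t. p dvd D s t \<longleftrightarrow> p dvd D s (t mod p)"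
begin

text \<open>Since \<open>p\<close> does not divide \<open>m\<close>, zeros modulo \<open>p\<close>
  can be combined with the congruences modulo \<open>m\<close> and \<open>m\<^sup>2\<close>.\<close>

definition good :: "int \<Rightarrow> bool" where
  "good p \<longleftrightarrow> prime p \<and> \<not> p dvd m \<and> card {s \<in> {0..<p}. p dvd K s} \<le> d \<and>
    (\<forall>s. card {t \<in> {0..<p}. p dvd D s t} \<le> d)"

text \<open>At most 2u + 1 values of s occur, each with at most 2v + 1 values of t; u v = A B / m^3
  is the main size.\<close>

definition u :: real where "u = A / real_of_int m"
definition v :: real where "v = B / (real_of_int m)\<^sup>2"

lemma u_pos: "u > 0" and v_pos: "v > 0"
  using m A B by (auto simp: u_def v_def)

lemma finite_G: "finite G"
proof (rule finite_subset)
  show "G \<subseteq> {s. \<bar>real_of_int s\<bar> \<le> A} \<times> {t. \<bar>real_of_int t\<bar> \<le> B}" using bounded by auto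
qed (intro finite_cartesian_product finite_abs_le_int)

lemma card_fst_le: "real (card (fst ` G)) \<le> 2 * u + 1"
proof (rule order_trans[OF card_residue_class_le[of m A]])
  show "m dvd x - y" if "x \<in> fst ` G" "y \<in> fst ` G" for x y
    using that cong_s by auto
  show "\<bar>real_of_int x\<bar> \<le> A" if "x \<in> fst ` G" for x
    using that bounded by auto
qed (use m A in \<open>auto simp: u_def\<close>)

lemma card_fiber_le: "real (card {t. (s, t) \<in> G}) \<le> 2 * v + 1"
proof (rule order_trans[OF card_residue_class_le[of "m\<^sup>2" B]])
  show "m\<^sup>2 dvd x - y" if "x \<in> {t. (s, t) \<in> G}" "y \<in> {t. (s, t) \<in> G}" for x y
    using that cong_t by auto
  show "\<bar>real_of_int x\<bar> \<le> B" if "x \<in> {t. (s, t) \<in> G}" for x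
    using that bounded by auto
qed (use m B in \<open>auto simp: v_def\<close>)

lemma card_G_le: "real (card G) \<le> (2 * u + 1) * (2 * v + 1)"
proof -
  have "real (card G) \<le> real (card (fst ` G)) * (2 * v + 1)"
    by (rule card_fibers_le[OF finite_G card_fiber_le])
  also have "\<dots> \<le> (2 * u + 1) * (2 * v + 1)"
    using card_fst_le v_pos by (intro mult_right_mono) auto
  finally show ?thesis .
qed

lemma good_coprime: "good p \<Longrightarrow> coprime m p" "good p \<Longrightarrow> coprime (m\<^sup>2) p" "good p \<Longrightarrow> p > 0"
  using prime_imp_coprime[of p m] by (auto simp: good_def coprime_commute prime_gt_0_int)

lemma card_prime_fiber_le:
  assumes p: "good p"
  shows "real (card {t. (s, t) \<in> G \<and> p dvd D s t}) \<le> real d * (2 * v / real_of_int p + 1)"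
proof -
  have "real (card {t. (s, t) \<in> G \<and> p dvd D s t})
    \<le> real d * (2 * B / (real_of_int (m\<^sup>2) * real_of_int p) + 1)"
  proof (rule card_residue_classes_le[where Z = "{t \<in> {0..<p}. p dvd D s t}"])
    show "finite {t \<in> {0..<p}. p dvd D s t}" by (rule finite_subset[of _ "{0..<p}"]) auto
    show "x mod p \<in> {t \<in> {0..<p}. p dvd D s t}" if "x \<in> {t. (s, t) \<in> G \<and> p dvd D s t}" for x
      using that good_coprime[OF p] D_mod by auto
    show "card {t \<in> {0..<p}. p dvd D s t} \<le> d" using p by (simp add: good_def)
  qed (use m B bounded cong_t good_coprime[OF p] in auto)
  thus ?thesis using m by (simp add: v_def field_simps)
qed

lemma card_prime_le:
  assumes p: "good p"
  shows "real (card {(s, t) \<in> G. p dvd K s \<and> p dvd D s t})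
    \<le> (real d * (2 * u / real_of_int p + 1)) * (real d * (2 * v / real_of_int p + 1))"
proof -
  define H where "H = {(s, t) \<in> G. p dvd K s \<and> p dvd D s t}"
  have fin: "finite H" by (rule finite_subset[OF _ finite_G]) (auto simp: H_def)
  have "real (card (fst ` H)) \<le> real d * (2 * A / (real_of_int m * real_of_int p) + 1)"
  proof (rule card_residue_classes_le[where Z = "{s \<in> {0..<p}. p dvd K s}"])
    show "finite {s \<in> {0..<p}. p dvd K s}" by (rule finite_subset[of _ "{0..<p}"]) auto
    show "x mod p \<in> {s \<in> {0..<p}. p dvd K s}" if "x \<in> fst ` H" for x
      using that good_coprime[OF p] K_mod by (auto simp: H_def)
    show "card {s \<in> {0..<p}. p dvd K s} \<le> d" using p by (simp add: good_def)
  qed (use m A bounded cong_s good_coprime[OF p] in \<open>auto simp: H_def\<close>)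
  hence s: "real (card (fst ` H)) \<le> real d * (2 * u / real_of_int p + 1)"
    using m by (simp add: u_def field_simps)
  have "real (card {t. (s, t) \<in> H}) \<le> real d * (2 * v / real_of_int p + 1)" for s
  proof -
    have "finite {t. (s, t) \<in> G \<and> p dvd D s t}"
      by (rule finite_subset[OF _ finite_abs_le_int[of B]]) (use bounded in auto)
    hence "card {t. (s, t) \<in> H} \<le> card {t. (s, t) \<in> G \<and> p dvd D s t}"
      by (intro card_mono) (auto simp: H_def)
    thus ?thesis using card_prime_fiber_le[OF p, of s] by linarith
  qed
  from card_fibers_le[OF fin this]
  have "real (card H) \<le> real (card (fst ` H)) * (real d * (2 * v / real_of_int p + 1))" .
  also have "\<dots> \<le> (real d * (2 * u / real_of_int p + 1)) * (real d * (2 * v / real_of_int p + 1))"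
    using s v_pos good_coprime[OF p] by (intro mult_right_mono) (auto intro!: add_nonneg_nonneg mult_nonneg_nonneg)
  finally show ?thesis unfolding H_def .
qed

text \<open>When K(s) = 0, counting prime divisors of K(s) gives nothing, so these few s are charged
  with their whole fibres.\<close>

lemma card_zero_le:
  assumes Z: "finite {s. K s = 0}" "card {s. K s = 0} \<le> d"
  shows "real (card {(s, t) \<in> G. K s = 0}) \<le> 2 * real d * (v + 1)"
proof -
  define H where "H = {(s, t) \<in> G. K s = 0}"
  have fin: "finite H" by (rule finite_subset[OF _ finite_G]) (auto simp: H_def)
  have "real (card {t. (s, t) \<in> H}) \<le> 2 * v + 1" for s
  proof -
    have "finite {t. (s, t) \<in> G}"
      by (rule finite_subset[OF _ finite_abs_le_int[of B]]) (use bounded in auto)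
    hence "card {t. (s, t) \<in> H} \<le> card {t. (s, t) \<in> G}"
      by (intro card_mono) (auto simp: H_def)
    thus ?thesis using card_fiber_le[of s] by linarith
  qed
  from card_fibers_le[OF fin this]
  have "real (card H) \<le> real (card (fst ` H)) * (2 * v + 1)" .
  also have "card (fst ` H) \<le> card {s. K s = 0}" by (rule card_mono[OF Z(1)]) (auto simp: H_def)
  hence "real (card (fst ` H)) * (2 * v + 1) \<le> real d * (2 * v + 1)"
    using Z(2) v_pos by (intro mult_right_mono) auto
  also have "\<dots> \<le> real d * (2 * (v + 1))" using v_pos by (intro mult_left_mono) auto
  finally show ?thesis unfolding H_def by (simp add: algebra_simps)
qed

text \<open>For p \<le> R \<le> min(u, v) both error terms 1 are absorbed, leaving at most 9 d^2 u v
  / p^2 pairs for each good p; the sum over p > M is then the sum of inverse squares of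
  primes.\<close>

lemma card_small_primes_le:
  assumes M: "M \<ge> 4" and R: "R \<le> u" "R \<le> v"
  shows "real (card {(s, t) \<in> G. \<exists>p. good p \<and> real_of_int p > M \<and> real_of_int p \<le> R \<and> p dvd K s \<and> p dvd D s t})
    \<le> 144 * (real d)\<^sup>2 * (u * v / (M * ln M))"
proof -
  define H where "H = (\<lambda>p::nat. {(s, t) \<in> G. int p dvd K s \<and> int p dvd D s t})"
  define N where "N = nat \<lfloor>M\<rfloor>"
  define P where "P = {p. prime p \<and> N < p \<and> p \<le> nat \<lfloor>R\<rfloor>}"
  define P' where "P' = {p \<in> P. good (int p)}"
  have finP: "finite P" by (rule finite_subset[of _ "{..nat \<lfloor>R\<rfloor>}"]) (auto simp: P_def)
  hence finP': "finite P'" by (simp add: P'_def)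
  have finH: "finite (H p)" for p by (rule finite_subset[OF _ finite_G]) (auto simp: H_def)
  have N: "N \<ge> 4" "real N \<le> M" "M / 2 \<le> real N"
  proof -
    show "N \<ge> 4" using M by (simp add: N_def le_nat_iff le_floor_iff)
    show "real N \<le> M" using M by (simp add: N_def)
    have "real N > M - 1" using M by (simp add: N_def)
    thus "M / 2 \<le> real N" using M by simp
  qed
  have sub: "{(s, t) \<in> G. \<exists>p. good p \<and> real_of_int p > M \<and> real_of_int p \<le> R \<and> p dvd K s \<and> p dvd D s t}
    \<subseteq> (\<Union>p\<in>P'. H p)"
  proof safe
    fix s t p assume *: "(s, t) \<in> G" "good p" "real_of_int p > M" "real_of_int p \<le> R" "p dvd K s" "p dvd D s t"
    have p: "p = int (nat p)" using good_coprime(3)[OF *(2)] by simp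
    have "prime (nat p)" using *(2) p by (metis good_def prime_nat_int_transfer)
    moreover have "N < nat p" using *(3) N(2) p by linarith
    moreover have "nat p \<le> nat \<lfloor>R\<rfloor>" using *(4) by (intro nat_mono) (simp add: le_floor_iff)
    ultimately have "nat p \<in> P'" using *(2) p by (simp add: P'_def P_def)
    moreover have "(s, t) \<in> H (nat p)" using * p by (simp add: H_def)
    ultimately show "(s, t) \<in> (\<Union>p\<in>P'. H p)" by blast
  qed
  have H: "real (card (H p)) \<le> 9 * (real d)\<^sup>2 * (u * v) * (1 / (real p)\<^sup>2)" if p: "p \<in> P'" for p
  proof -
    have good: "good (int p)" using p by (simp add: P'_def)
    have "p > 0" using good_coprime(3)[OF good] by simp
    have "p \<le> nat \<lfloor>R\<rfloor>" using p by (simp add: P'_def P_def)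
    hence "int p \<le> \<lfloor>R\<rfloor>" using \<open>p > 0\<close> by linarith
    hence "real p \<le> R" by (simp add: le_floor_iff)
    hence le: "1 \<le> u / real p" "1 \<le> v / real p" using R \<open>p > 0\<close> by (simp_all add: pos_le_divide_eq)
    have "real (card (H p)) \<le> (real d * (2 * u / real p + 1)) * (real d * (2 * v / real p + 1))"
      using card_prime_le[OF good] by (simp add: H_def)
    also have "\<dots> \<le> (real d * (3 * (u / real p))) * (real d * (3 * (v / real p)))"
    proof (rule mult_mono)
      show "real d * (2 * u / real p + 1) \<le> real d * (3 * (u / real p))"
        using le(1) by (intro mult_left_mono) auto
      show "real d * (2 * v / real p + 1) \<le> real d * (3 * (v / real p))"
        using le(2) by (intro mult_left_mono) auto
    qed (use u_pos v_pos in auto)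
    also have "\<dots> = 9 * (real d)\<^sup>2 * (u * v) * (1 / (real p)\<^sup>2)" by (simp add: power2_eq_square)
    finally show ?thesis .
  qed
  have "card {(s, t) \<in> G. \<exists>p. good p \<and> real_of_int p > M \<and> real_of_int p \<le> R \<and> p dvd K s \<and> p dvd D s t}
      \<le> card (\<Union>p\<in>P'. H p)"
    by (rule card_mono[OF _ sub]) (use finP' finH in auto)
  also have "\<dots> \<le> (\<Sum>p\<in>P'. card (H p))" by (rule card_UN_le[OF finP'])
  finally have "real (card {(s, t) \<in> G. \<exists>p. good p \<and> real_of_int p > M \<and> real_of_int p \<le> R \<and> p dvd K s \<and> p dvd D s t})
      \<le> (\<Sum>p\<in>P'. real (card (H p)))" by (simp flip: of_nat_sum)
  also have "\<dots> \<le> (\<Sum>p\<in>P'. 9 * (real d)\<^sup>2 * (u * v) * (1 / (real p)\<^sup>2))" by (rule sum_mono) (rule H)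
  also have "\<dots> = 9 * (real d)\<^sup>2 * (u * v) * (\<Sum>p\<in>P'. 1 / (real p)\<^sup>2)" by (simp only: sum_distrib_left)
  also have "\<dots> \<le> 9 * (real d)\<^sup>2 * (u * v) * (16 / (M * ln M))"
  proof (rule mult_left_mono)
    have lnM: "ln M > 0" using M by simp
    have "(\<Sum>p\<in>P'. 1 / (real p)\<^sup>2) \<le> (\<Sum>p\<in>P. 1 / (real p)\<^sup>2)"
      by (rule sum_mono2[OF finP]) (auto simp: P'_def)
    also have "\<dots> \<le> 4 * ln 2 / (real N * ln (real N))"
      unfolding P_def by (rule sum_primes_inverse_square_le) (use N in simp)
    also have "\<dots> \<le> 4 / (M / 2 * (ln M / 2))"
    proof (rule frac_le)
      show "4 * ln 2 \<le> (4::real)" using ln_le_minus_one[of 2] by simp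
      \<comment> \<open>As M \<ge> 4, sqrt M \<le> M/2 \<le> N, hence ln N \<ge> ln M / 2. The two
        halvings turn 4 into 16, and 9 times 16 is 144.\<close>
      have "sqrt M \<le> real N"
      proof (rule real_le_lsqrt)
        have "M * 4 \<le> M * M" using M by (intro mult_left_mono) auto
        hence "M \<le> (M / 2)\<^sup>2" by (simp add: power2_eq_square)
        also have "\<dots> \<le> (real N)\<^sup>2" using N M by (intro power_mono) auto
        finally show "M \<le> (real N)\<^sup>2" .
      qed (use M in auto)
      hence "ln (sqrt M) \<le> ln (real N)" using M N(1) by (subst ln_le_cancel_iff) auto
      hence "ln M / 2 \<le> ln (real N)" using M by (simp add: ln_sqrt)
      thus "M / 2 * (ln M / 2) \<le> real N * ln (real N)"
        using N M lnM by (intro mult_mono) auto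
    qed (use M lnM in auto)
    also have "\<dots> = 16 / (M * ln M)" by simp
    finally show "(\<Sum>p\<in>P'. 1 / (real p)\<^sup>2) \<le> 16 / (M * ln M)" .
  qed (use u_pos v_pos in auto)
  also have "\<dots> = 144 * (real d)\<^sup>2 * (u * v / (M * ln M))" by simp
  finally show ?thesis .
qed

text \<open>For each s the primes above R are counted as divisors of K(s): at most (2c + 1) T / (ln
  R + ln T) of them. Each admits at most d(2v/p + 1) \<le> 3 d v / R values of t because R \<le> v,
  and at most 3u values of s occur because u \<ge> 1.\<close>

lemma card_large_primes_le:
  assumes R: "R = min u v" "R \<ge> 1" and T: "T > 0" "ln R + ln T > 0" and c: "c \<ge> 0"
    and K: "\<And>s t. (s, t) \<in> G \<Longrightarrow> K s \<noteq> 0 \<Longrightarrow> ln (real_of_int \<bar>K s\<bar>) \<le> c * T"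
  shows "real (card {(s, t) \<in> G. K s \<noteq> 0 \<and> (\<exists>p. good p \<and> real_of_int p > R \<and> p dvd K s \<and> p dvd D s t)})
    \<le> 9 * real d * (2 * c + 1) * (T * u * v / (R * (ln R + ln T)))"
proof -
  define L where "L = ln R + ln T"
  define H where "H = {(s, t) \<in> G. K s \<noteq> 0 \<and> (\<exists>p. good p \<and> real_of_int p > R \<and> p dvd K s \<and> p dvd D s t)}"
  have fin: "finite H" by (rule finite_subset[OF _ finite_G]) (auto simp: H_def)
  have L: "L > 0" using T by (simp add: L_def)
  define b where "b = (2 * c + 1) * T / L * (real d * (3 * v / R))"
  have b: "b \<ge> 0" using c T L R v_pos by (simp add: b_def)
  have "real (card {t. (s, t) \<in> H}) \<le> b" for s
  proof (cases "{t. (s, t) \<in> H} = {}")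
    case False
    then obtain t0 where t0: "(s, t0) \<in> G" "K s \<noteq> 0" by (auto simp: H_def)
    define P where "P = {p. prime p \<and> good (int p) \<and> real p > R \<and> int p dvd K s}"
    define F where "F = (\<lambda>p. {t. (s, t) \<in> G \<and> int p dvd D s t})"
    have dvd: "p dvd nat \<bar>K s\<bar>" if "p \<in> P" for p
    proof -
      have "int p dvd int (nat \<bar>K s\<bar>)" using that by (simp add: P_def)
      thus ?thesis by (simp only: int_dvd_int_iff)
    qed
    have finP: "finite P"
      by (rule finite_subset[of _ "{..nat \<bar>K s\<bar>}"]) (use dvd t0 dvd_imp_le in auto)
    have finF: "finite (F p)" for p
      by (rule finite_subset[OF _ finite_abs_le_int[of B]]) (use bounded in \<open>auto simp: F_def\<close>)
    have sub: "{t. (s, t) \<in> H} \<subseteq> (\<Union>p\<in>P. F p)"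
    proof
      fix t assume "t \<in> {t. (s, t) \<in> H}"
      then obtain p where *: "(s, t) \<in> G" "good p" "real_of_int p > R" "p dvd K s" "p dvd D s t"
        by (auto simp: H_def)
      have p: "p = int (nat p)" using good_coprime(3)[OF *(2)] by simp
      have "prime (nat p)" using *(2) p by (metis good_def prime_nat_int_transfer)
      hence "nat p \<in> P" "t \<in> F (nat p)" using * p by (simp_all add: P_def F_def)
      thus "t \<in> (\<Union>p\<in>P. F p)" by blast
    qed
    have F: "real (card (F p)) \<le> real d * (3 * v / R)" if p: "p \<in> P" for p
    proof -
      have "real (card (F p)) \<le> real d * (2 * v / real p + 1)"
        using card_prime_fiber_le[of "int p" s] p by (simp add: P_def F_def)
      also have "\<dots> \<le> real d * (3 * v / R)"
      proof (rule mult_left_mono)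
        have "2 * v / real p \<le> 2 * v / R" using p R v_pos by (intro divide_left_mono) (auto simp: P_def)
        moreover have "1 \<le> v / R" using R by (simp add: pos_le_divide_eq)
        moreover have "3 * v / R = 2 * v / R + v / R" by (simp add: add_divide_distrib[symmetric])
        ultimately show "2 * v / real p + 1 \<le> 3 * v / R" by linarith
      qed simp
      finally show ?thesis .
    qed
    have "real (card P) * (ln R + ln T) \<le> (2 * c + 1) * T"
    proof (rule card_large_prime_divisors_le[OF finP])
      show "ln (real (nat \<bar>K s\<bar>)) \<le> c * T" using K[OF t0] by simp
    qed (use dvd t0 R T c in \<open>auto simp: P_def\<close>)
    hence cardP: "real (card P) \<le> (2 * c + 1) * T / L"
      using L by (simp add: L_def pos_le_divide_eq)
    have "card {t. (s, t) \<in> H} \<le> card (\<Union>p\<in>P. F p)"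
      by (rule card_mono[OF _ sub]) (use finP finF in auto)
    also have "\<dots> \<le> (\<Sum>p\<in>P. card (F p))" by (rule card_UN_le[OF finP])
    finally have "real (card {t. (s, t) \<in> H}) \<le> (\<Sum>p\<in>P. real (card (F p)))" by (simp flip: of_nat_sum)
    also have "\<dots> \<le> (\<Sum>p\<in>P. real d * (3 * v / R))" by (rule sum_mono) (rule F)
    also have "\<dots> = real (card P) * (real d * (3 * v / R))" by simp
    also have "\<dots> \<le> b" unfolding b_def
      using cardP v_pos R by (intro mult_right_mono) auto
    finally show ?thesis .
  qed (use b in simp)
  from card_fibers_le[OF fin this] have "real (card H) \<le> real (card (fst ` H)) * b" .
  also have "\<dots> \<le> (3 * u) * b"
  proof (rule mult_right_mono[OF _ b])
    have "card (fst ` H) \<le> card (fst ` G)"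
      by (rule card_mono) (use finite_G in \<open>auto simp: H_def\<close>)
    moreover have "u \<ge> 1" using R by simp
    ultimately show "real (card (fst ` H)) \<le> 3 * u" using card_fst_le by linarith
  qed
  also have "\<dots> = 9 * real d * (2 * c + 1) * (T * u * v / (R * L))"
    by (simp add: b_def mult_ac)
  finally show ?thesis unfolding H_def L_def .
qed

text \<open>The cases u < 1, v < 1 and M < Q follow from the trivial bound. The bound on the zeros
  of \<open>K\<close> is conditional on a good prime above \<open>Q\<close>, since \<open>K\<close>
  might vanish identically; if M \<ge> Q and no such prime exists, the set is empty.\<close>

lemma card_common_prime_le:
  fixes M R T L Q c :: real
  assumes M: "M > 1" and R: "R = min u v" and T: "T > 0" and L: "L = ln R + ln T" "L > 0"
    and c: "c \<ge> 0" and Q: "Q \<ge> 4"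
    and good: "\<And>p. prime p \<Longrightarrow> real_of_int p > Q \<Longrightarrow> real_of_int p > M \<Longrightarrow> \<not> p dvd m \<Longrightarrow> good p"
    and zero: "\<And>p. good p \<Longrightarrow> real_of_int p > Q \<Longrightarrow> finite {s. K s = 0} \<and> card {s. K s = 0} \<le> d"
    and K: "\<And>s t. (s, t) \<in> G \<Longrightarrow> K s \<noteq> 0 \<Longrightarrow> ln (real_of_int \<bar>K s\<bar>) \<le> c * T"
  shows "real (card {(s, t) \<in> G. \<exists>p. prime p \<and> real_of_int p > M \<and> \<not> p dvd m \<and> p dvd K s \<and> p dvd D s t})
    \<le> (9 + 9 * (Q * ln Q) + 2 * real d + 144 * (real d)\<^sup>2 + 9 * real d * (2 * c + 1))
      * (T * u * v / (R * L) + u * v / (M * ln M) + v + 1)"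
    (is "real (card ?S) \<le> ?C * (?w1 + ?w2 + v + 1)")
proof -
  have w1: "?w1 \<ge> 0" using T L R u_pos v_pos by simp
  have w2: "?w2 \<ge> 0" using M u_pos v_pos by simp
  have QlnQ: "Q * ln Q \<ge> 0" using Q by simp
  define C1 where "C1 = 2 * real d + 144 * (real d)\<^sup>2 + 9 * real d * (2 * c + 1)"
  have C1: "C1 \<ge> 0" using c by (simp add: C1_def)
  define w where "w = ?w1 + ?w2 + v + 1"
  have w: "w \<ge> 0" "?w1 \<le> w" "?w2 \<le> w" "v + 1 \<le> w" using w1 w2 v_pos by (simp_all add: w_def)
  have "card ?S \<le> card G" by (rule card_mono[OF finite_G]) auto
  hence triv: "real (card ?S) \<le> (2 * u + 1) * (2 * v + 1)" using card_G_le by linarith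
  have C_ge: "x * w \<le> (9 + 9 * (Q * ln Q) + C1) * w" if "x \<le> 9 \<or> x \<le> 9 * (Q * ln Q) \<or> x \<le> C1" for x
    using that QlnQ C1 w by (intro mult_right_mono) auto
  consider "u < 1" | "u \<ge> 1" "v < 1" | "u \<ge> 1" "v \<ge> 1" "M < Q" | "u \<ge> 1" "v \<ge> 1" "M \<ge> Q"
    by linarith
  hence "real (card ?S) \<le> (9 + 9 * (Q * ln Q) + C1) * w"
  proof cases
    case 1
    \<comment> \<open>With fewer than three values of s the terms v + 1 suffice.\<close>
    have "(2 * u + 1) * (2 * v + 1) \<le> 3 * (2 * v + 1)" using 1 v_pos by (intro mult_right_mono) auto
    also have "\<dots> \<le> 6 * (v + 1)" by simp
    also have "\<dots> \<le> 6 * w" using w by simp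
    also have "\<dots> \<le> (9 + 9 * (Q * ln Q) + C1) * w" by (rule C_ge) simp
    finally show ?thesis using triv by linarith
  next
    case 2
    \<comment> \<open>Here ln R < 0, so L < ln T < T; as R = v, the first term equals (T / L) u and
      is at least u, while the number of t is bounded.\<close>
    have "R = v" using R 2 by simp
    have "ln v < 0" using 2 v_pos by simp
    moreover have "L = ln v + ln T" using L(1) \<open>R = v\<close> by simp
    ultimately have "L \<le> T" using ln_less_self[OF T] by linarith
    have "?w1 = T / L * u" using \<open>R = v\<close> v_pos by simp
    moreover have "1 * u \<le> T / L * u"
      using \<open>L \<le> T\<close> L u_pos by (intro mult_right_mono) (auto simp: pos_le_divide_eq)
    ultimately have "u \<le> w" using w by linarith
    have "(2 * u + 1) * (2 * v + 1) \<le> (3 * u) * 3" using 2 v_pos u_pos by (intro mult_mono) auto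
    also have "\<dots> \<le> 9 * w" using \<open>u \<le> w\<close> by simp
    also have "\<dots> \<le> (9 + 9 * (Q * ln Q) + C1) * w" by (rule C_ge) simp
    finally show ?thesis using triv by linarith
  next
    case 3
    \<comment> \<open>For bounded M the second term is comparable to u v itself.\<close>
    have "M * ln M \<le> Q * ln Q" using 3 M Q by (intro mult_mono) auto
    hence "u * v * (M * ln M) \<le> u * v * (Q * ln Q)" using u_pos v_pos by (intro mult_left_mono) auto
    hence "u * v \<le> Q * ln Q * ?w2" using M by (simp add: pos_le_divide_eq mult_ac)
    also have "\<dots> \<le> Q * ln Q * w" using QlnQ w by (intro mult_left_mono) auto
    finally have uv: "u * v \<le> Q * ln Q * w" .
    have "(2 * u + 1) * (2 * v + 1) \<le> (3 * u) * (3 * v)" using 3 by (intro mult_mono) auto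
    also have "\<dots> \<le> (9 * (Q * ln Q)) * w" using uv by simp
    also have "\<dots> \<le> (9 + 9 * (Q * ln Q) + C1) * w" by (rule C_ge) simp
    finally show ?thesis using triv by linarith
  next
    case 4
    have R1: "R \<ge> 1" using R 4 by simp
    \<comment> \<open>The pairs are split into zeros of \<open>K\<close>, primes in (M, R], and
      primes above R with nonzero K(s); they are charged to v + 1, the second term and the first
      term.\<close>
    define S0 where "S0 = {(s, t) \<in> G. K s = 0}"
    define S1 where "S1 = {(s, t) \<in> G. \<exists>p. good p \<and> real_of_int p > M \<and> real_of_int p \<le> R \<and> p dvd K s \<and> p dvd D s t}"
    define S2 where "S2 = {(s, t) \<in> G. K s \<noteq> 0 \<and> (\<exists>p. good p \<and> real_of_int p > R \<and> p dvd K s \<and> p dvd D s t)}"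
    have fin: "finite S0" "finite S1" "finite S2"
      by (rule finite_subset[OF _ finite_G], force simp: S0_def S1_def S2_def)+
    show ?thesis
    proof (cases "?S = {}")
      case False
      then obtain p where p: "prime p" "real_of_int p > M" "\<not> p dvd m" by auto
      with 4 have pQ: "real_of_int p > Q" by linarith
      have S0: "real (card S0) \<le> 2 * real d * (v + 1)"
        unfolding S0_def using zero[OF good[OF p(1) pQ p(2,3)] pQ] by (intro card_zero_le) auto
      have S1: "real (card S1) \<le> 144 * (real d)\<^sup>2 * ?w2"
        unfolding S1_def by (rule card_small_primes_le) (use 4 Q R in auto)
      have S2: "real (card S2) \<le> 9 * real d * (2 * c + 1) * ?w1"
        unfolding S2_def L(1) by (rule card_large_primes_le[OF R R1 T _ c K]) (use L in auto)
      have "?S \<subseteq> S0 \<union> S1 \<union> S2"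
      proof
        fix x assume "x \<in> ?S"
        then obtain s t p where *: "x = (s, t)" "(s, t) \<in> G" "prime p" "M < real_of_int p" "\<not> p dvd m"
          "p dvd K s" "p dvd D s t" by auto
        have "good p" using good[of p] * 4 by auto
        thus "x \<in> S0 \<union> S1 \<union> S2"
          using * by (cases "K s = 0"; cases "real_of_int p \<le> R") (auto simp: S0_def S1_def S2_def)
      qed
      hence "card ?S \<le> card (S0 \<union> S1 \<union> S2)" using fin by (intro card_mono) auto
      also have "\<dots> \<le> card S0 + card S1 + card S2"
        using card_Un_le[of "S0 \<union> S1" S2] card_Un_le[of S0 S1] by linarith
      finally have "real (card ?S) \<le> real (card S0) + real (card S1) + real (card S2)" by linarith
      also have "\<dots> \<le> 2 * real d * w + 144 * (real d)\<^sup>2 * w + 9 * real d * (2 * c + 1) * w"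
      proof (intro add_mono order_trans[OF S0] order_trans[OF S1] order_trans[OF S2] mult_left_mono)
      qed (use w c in auto)
      also have "\<dots> = C1 * w" by (simp add: C1_def distrib_right)
      also have "\<dots> \<le> (9 + 9 * (Q * ln Q) + C1) * w" by (rule C_ge) simp
      finally show ?thesis .
    qed (use w C1 QlnQ in \<open>simp only: card.empty, simp\<close>)
  qed
  thus ?thesis by (simp only: C1_def w_def add.assoc)
qed

end

section \<open>The theorem\<close>

lemma eval_XY_1: "eval_XY f x 1 = poly (map_poly (\<lambda>q. poly q 1) f) x"
  unfolding eval_XY_def
proof (induction f)
  case (pCons a f)
  have "map_poly (\<lambda>q. poly q 1) (pCons a f) = pCons (poly a 1) (map_poly (\<lambda>q. poly q 1) f)"
    by (intro poly_eqI) (simp add: coeff_map_poly coeff_pCons split: nat.split)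
  thus ?case using pCons.IH by simp
qed simp

lemma eval_XY_binary_form: "eval_XY (binary_form d c) x 1 = poly (dehom_form d c) x"
  by (simp add: eval_XY_1 dehom_form_eq)

lemma eval_XY_pderiv_binary_form:
  "eval_XY (pderiv (binary_form d c)) x 1 = poly (pderiv (dehom_form d c)) x"
proof -
  have "map_poly (\<lambda>q. poly q 1) (pderiv f) = pderiv (map_poly (\<lambda>q. poly q 1) f)" for f :: "'a poly poly"
    by (intro poly_eqI) (simp add: coeff_map_poly coeff_pderiv of_nat_poly del: of_nat_Suc)
  thus ?thesis by (simp add: eval_XY_1 dehom_form_eq)
qed

lemma dehom_form_upd_last:
  assumes "n \<ge> 2"
  shows "dehom_form n (a(n - 1 := s, n := t)) = dehom_form n (a(n - 1 := 0, n := 0)) + [:t, s:]"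
proof (rule poly_eqI)
  have last: "n - Suc 0 \<noteq> n" using assms by simp
  fix i :: nat
  consider "i = 0" | "i = 1" | "i \<ge> 2" by linarith
  thus "coeff (dehom_form n (a(n - 1 := s, n := t))) i = coeff (dehom_form n (a(n - 1 := 0, n := 0)) + [:t, s:]) i"
  proof cases
    case 3
    hence "n - i \<noteq> n - 1 \<and> n - i \<noteq> n" if "i \<le> n" using that by linarith
    thus ?thesis using 3 by (auto simp: coeff_dehom_form coeff_pCons split: nat.split)
  qed (use assms last in \<open>auto simp: coeff_dehom_form\<close>)
qed

lemma dvd_poly_mod: "p dvd poly P x \<longleftrightarrow> p dvd poly P (x mod p)" for p x :: int
proof -
  have "p dvd x - x mod p" by (simp add: minus_mod_eq_mult_div)
  hence "p dvd poly P x - poly P (x mod p)" using dvd_poly_diff dvd_trans by blast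
  thus ?thesis by (metis diff_add_cancel dvd_add_right_iff)
qed

theorem theorem1:
  fixes n :: nat
  assumes "n \<ge> 3"
  shows "\<exists>C::real. C > 0 \<and>
    (\<forall>(m::int) (l::int) (M::real) (A::real) (B::real) (a :: nat \<Rightarrow> int) (T::real) (R::real).
      m \<ge> 1 \<longrightarrow> M > 1 \<longrightarrow> A \<ge> 2 \<longrightarrow> B > 0 \<longrightarrow>
      (\<forall>p::int. prime p \<longrightarrow> p dvd gcd (a 0) (a 1) \<longrightarrow> real_of_int p < M \<or> p dvd m) \<longrightarrow>
      T = ln (Max ({real_of_int \<bar>a i\<bar> | i. i \<le> n - 2} \<union> {A})) \<longrightarrow>
      R = min (A / real_of_int m) (B / (real_of_int m)\<^sup>2) \<longrightarrow>
      ln R + ln T > 0 \<longrightarrow>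
      real (card {(s::int, t::int).
          \<bar>real_of_int s\<bar> \<le> A \<and> \<bar>real_of_int t\<bar> \<le> B \<and>
          m\<^sup>2 dvd eval_XY (binary_form n (a(n - 1 := s, n := t))) l 1 \<and>
          m dvd eval_XY (pderiv (binary_form n (a(n - 1 := s, n := t)))) l 1 \<and>
          (\<exists>p::int. prime p \<and> real_of_int p > M \<and> \<not> p dvd m \<and>
            p dvd gcd (Ksh n (a(n - 1 := s))) (disc n (a(n - 1 := s, n := t))))})
      \<le> C * (T / (R * (ln R + ln T)) + 1 / (M * ln M) + real_of_int m / A
              + (real_of_int m) ^ 3 / (A * B)) * (A * B / (real_of_int m) ^ 3))"
proof -
  have n: "n \<ge> 1" "n \<ge> 2" using assms by auto
  obtain Q0 :: int where Q0: "\<forall>p a. prime p \<longrightarrow> p > Q0 \<longrightarrow> \<not> p dvd gcd (a 0) (a 1) \<longrightarrow>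
    card {s \<in> {0..<p}. p dvd Ksh n (a(n - 1 := s))} \<le> n * n \<and>
    (\<forall>s. card {t \<in> {0..<p}. p dvd disc n (a(n - 1 := s, n := t))} \<le> n)"
    using ex_card_residues_le[OF assms] ..
  obtain K0 :: int and E :: nat where K0: "K0 \<ge> 1"
    "\<forall>x H. H \<ge> 1 \<longrightarrow> (\<forall>i<n. \<bar>x i\<bar> \<le> H) \<longrightarrow> \<bar>Ksh n x\<bar> \<le> K0 * H ^ E"
    using abs_Ksh_le[OF n(2)] by auto
  \<comment> \<open>\<open>Q\<close> exceeds n^2 so that a prime above it has more residues than
    \<open>K\<close> may have zeros, and 4 for the sum over small primes. In \<open>c\<close>, ln K0
    is absorbed into a multiple of T by T \<ge> ln 2.\<close>
  define Q where "Q = max (real_of_int Q0) (max (real (n * n)) 4)"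
  define c where "c = ln (real_of_int K0) / ln 2 + real E"
  define d where "d = n * n"
  define C where "C = 9 + 9 * (Q * ln Q) + 2 * real d + 144 * (real d)\<^sup>2 + 9 * real d * (2 * c + 1)"
  have Q: "Q \<ge> 4" by (simp add: Q_def)
  have c: "c \<ge> 0" using K0(1) by (simp add: c_def)
  have "Q * ln Q \<ge> 0" "real d * (2 * c + 1) \<ge> 0" using Q c by simp_all
  hence "C > 0" by (simp add: C_def add_pos_nonneg)
  moreover have "real (card {(s::int, t::int).
          \<bar>real_of_int s\<bar> \<le> A \<and> \<bar>real_of_int t\<bar> \<le> B \<and>
          m\<^sup>2 dvd eval_XY (binary_form n (a(n - 1 := s, n := t))) l 1 \<and>
          m dvd eval_XY (pderiv (binary_form n (a(n - 1 := s, n := t)))) l 1 \<and>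
          (\<exists>p::int. prime p \<and> real_of_int p > M \<and> \<not> p dvd m \<and>
            p dvd gcd (Ksh n (a(n - 1 := s))) (disc n (a(n - 1 := s, n := t))))})
      \<le> C * (T / (R * (ln R + ln T)) + 1 / (M * ln M) + real_of_int m / A
              + (real_of_int m) ^ 3 / (A * B)) * (A * B / (real_of_int m) ^ 3)"
    if m: "m \<ge> 1" and M: "M > 1" and A: "A \<ge> 2" and B: "B > 0"
      and gcd: "\<forall>p::int. prime p \<longrightarrow> p dvd gcd (a 0) (a 1) \<longrightarrow> real_of_int p < M \<or> p dvd m"
      and T: "T = ln (Max ({real_of_int \<bar>a i\<bar> | i. i \<le> n - 2} \<union> {A}))"
      and R: "R = min (A / real_of_int m) (B / (real_of_int m)\<^sup>2)"
      and L: "ln R + ln T > 0"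
    for m l :: int and M A B T R :: real and a :: "nat \<Rightarrow> int"
  proof -
    define G where "G = {(s, t). \<bar>real_of_int s\<bar> \<le> A \<and> \<bar>real_of_int t\<bar> \<le> B \<and>
      m\<^sup>2 dvd eval_XY (binary_form n (a(n - 1 := s, n := t))) l 1 \<and>
      m dvd eval_XY (pderiv (binary_form n (a(n - 1 := s, n := t)))) l 1}"
    define K where "K = (\<lambda>s. Ksh n (a(n - 1 := s)))"
    define D where "D = (\<lambda>s t. disc n (a(n - 1 := s, n := t)))"
    define g where "g = dehom_form n (a(n - 1 := 0, n := 0))"
    \<comment> \<open>Since s and t enter f linearly, the derivative condition fixes s modulo m, and
      for given s the other condition fixes t modulo m^2.\<close>
    have G: "m\<^sup>2 dvd poly g l + s * l + t" "m dvd poly (pderiv g) l + s" if "(s, t) \<in> G" for s t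
    proof -
      have eq: "dehom_form n (a(n - 1 := s, n := t)) = g + [:t, s:]"
        unfolding g_def by (rule dehom_form_upd_last[OF n(2)])
      have "poly (dehom_form n (a(n - 1 := s, n := t))) l = poly g l + s * l + t"
        "poly (pderiv (dehom_form n (a(n - 1 := s, n := t)))) l = poly (pderiv g) l + s"
        unfolding eq by (simp_all add: pderiv_add pderiv_pCons)
      with that show "m\<^sup>2 dvd poly g l + s * l + t" "m dvd poly (pderiv g) l + s"
        by (simp_all only: G_def eval_XY_binary_form eval_XY_pderiv_binary_form mem_Collect_eq prod.case)
    qed
    interpret congruence_sieve G m A B K D d
    proof
      show "\<bar>real_of_int s\<bar> \<le> A \<and> \<bar>real_of_int t\<bar> \<le> B" if "(s, t) \<in> G" for s t
        using that by (simp add: G_def)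
      show "m dvd s - s'" if "(s, t) \<in> G" "(s', t') \<in> G" for s t s' t'
        using dvd_diff[OF G(2)[OF that(1)] G(2)[OF that(2)]] by simp
      show "m\<^sup>2 dvd t - t'" if "(s, t) \<in> G" "(s, t') \<in> G" for s t t'
        using dvd_diff[OF G(1)[OF that(1)] G(1)[OF that(2)]] by simp
      show "p dvd K s \<longleftrightarrow> p dvd K (s mod p)" for p s
        unfolding K_def poly_Ksh_poly[OF n(1), symmetric] by (rule dvd_poly_mod)
      show "p dvd D s t \<longleftrightarrow> p dvd D s (t mod p)" for p s t
        unfolding D_def poly_disc_poly[symmetric] by (rule dvd_poly_mod)
    qed (use m A B in auto)
    have good: "good p" if p: "prime p" "real_of_int p > Q" "real_of_int p > M" "\<not> p dvd m" for p
    proof -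
      have "\<not> p dvd gcd (a 0) (a 1)" using gcd[rule_format, OF p(1)] p(3,4) by linarith
      moreover have "p > Q0" using p(2) by (simp add: Q_def)
      ultimately have "card {s \<in> {0..<p}. p dvd K s} \<le> n * n \<and> (\<forall>s. card {t \<in> {0..<p}. p dvd D s t} \<le> n)"
        unfolding K_def D_def by (intro Q0[rule_format] p(1))
      moreover have "k \<le> n * n" if "k \<le> n" for k
        using that mult_le_mono[of 1 n n n] n by linarith
      ultimately have "card {s \<in> {0..<p}. p dvd K s} \<le> d \<and> (\<forall>s. card {t \<in> {0..<p}. p dvd D s t} \<le> d)"
        unfolding d_def by blast
      thus ?thesis using p by (simp add: good_def)
    qed
    have zero: "finite {s. K s = 0} \<and> card {s. K s = 0} \<le> d" if p: "good p" "real_of_int p > Q" for p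
    proof -
      define P where "P = Ksh_poly n a"
      have K: "K s = poly P s" for s by (simp only: K_def P_def poly_Ksh_poly[OF n(1)])
      \<comment> \<open>If \<open>P\<close> were 0, all p residues would be zeros modulo p, whereas
        \<open>good p\<close> allows at most d < p.\<close>
      have "P \<noteq> 0"
      proof
        assume "P = 0"
        hence "{s \<in> {0..<p}. p dvd K s} = {0..<p}" by (auto simp: K)
        hence "nat p \<le> d" using p(1) by (simp add: good_def)
        moreover have "real_of_int p > real d" using p(2) by (simp add: Q_def d_def)
        ultimately show False by linarith
      qed
      have "card {s. poly P s = 0} \<le> n * (n - 2)"
        using card_poly_roots_bound[OF \<open>P \<noteq> 0\<close>] degree_Ksh_poly[OF n(2), of a] unfolding P_def by linarith
      also have "\<dots> \<le> d" by (simp add: d_def)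
      finally show ?thesis using poly_roots_finite[OF \<open>P \<noteq> 0\<close>] by (simp add: K)
    qed
    define X where "X = {real_of_int \<bar>a i\<bar> | i. i \<le> n - 2} \<union> {A}"
    have X: "finite X" by (simp add: X_def setcompr_eq_image)
    have MaxX: "x \<le> Max X" if "x \<in> X" for x using X that by simp
    have "A \<le> Max X" by (rule MaxX) (simp add: X_def)
    with \<open>A \<ge> 2\<close> have "2 \<le> Max X" by linarith
    hence expT: "exp T = Max X" and T2: "T \<ge> ln 2" unfolding T X_def[symmetric] by simp_all
    have T0: "T > 0" using T2 by (rule less_le_trans[rotated]) simp
    have Ksize: "ln (real_of_int \<bar>K s\<bar>) \<le> c * T" if st: "(s, t) \<in> G" "K s \<noteq> 0" for s t
    proof -
      \<comment> \<open>The size bound needs an integer H; rounding down is harmless because the a_i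
        and s are integers. It covers s since |s| \<le> A \<le> exp T.\<close>
      define H where "H = \<lfloor>exp T\<rfloor>"
      have H: "H \<ge> 1" "real_of_int H \<le> exp T" using T0 by (simp_all add: H_def le_floor_iff)
      have "\<bar>K s\<bar> \<le> K0 * H ^ E"
        unfolding K_def
      proof (rule K0(2)[rule_format, OF H(1)])
        fix i assume "i < n"
        hence "i = n - 1 \<or> i \<le> n - 2 \<and> i \<noteq> n - 1" by linarith
        moreover have "real_of_int \<bar>a i\<bar> \<le> exp T" if "i \<le> n - 2"
          unfolding expT by (rule MaxX) (use that in \<open>auto simp: X_def\<close>)
        moreover have "real_of_int \<bar>s\<bar> \<le> exp T"
          using st(1) \<open>A \<le> Max X\<close> unfolding expT by (simp add: G_def)
        ultimately show "\<bar>(a(n - 1 := s)) i\<bar> \<le> H" by (auto simp: H_def le_floor_iff)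
      qed
      hence "real_of_int \<bar>K s\<bar> \<le> real_of_int (K0 * H ^ E)" by (simp only: of_int_le_iff)
      also have "\<dots> \<le> real_of_int K0 * exp T ^ E"
        using K0(1) H by (simp add: mult_left_mono power_mono)
      finally have "ln (real_of_int \<bar>K s\<bar>) \<le> ln (real_of_int K0 * exp T ^ E)"
        using st(2) by (subst ln_le_cancel_iff) (use K0(1) in auto)
      also have "\<dots> = ln (real_of_int K0) + real E * T" using K0(1) by (simp add: ln_mult ln_realpow)
      also have "ln (real_of_int K0) \<le> ln (real_of_int K0) / ln 2 * T"
        using T2 K0(1) mult_left_mono[of "ln 2" T "ln (real_of_int K0)"] by (simp add: pos_le_divide_eq)
      finally show ?thesis by (simp add: c_def distrib_right)
    qed
    have "real (card {(s, t) \<in> G. \<exists>p. prime p \<and> real_of_int p > M \<and> \<not> p dvd m \<and> p dvd K s \<and> p dvd D s t})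
        \<le> C * (T * u * v / (R * (ln R + ln T)) + u * v / (M * ln M) + v + 1)"
      unfolding C_def
      by (rule card_common_prime_le[OF M _ T0 refl L c Q good zero Ksize]) (use R in \<open>auto simp: u_def v_def\<close>)
    also have "{(s, t) \<in> G. \<exists>p. prime p \<and> real_of_int p > M \<and> \<not> p dvd m \<and> p dvd K s \<and> p dvd D s t}
      = {(s::int, t::int).
          \<bar>real_of_int s\<bar> \<le> A \<and> \<bar>real_of_int t\<bar> \<le> B \<and>
          m\<^sup>2 dvd eval_XY (binary_form n (a(n - 1 := s, n := t))) l 1 \<and>
          m dvd eval_XY (pderiv (binary_form n (a(n - 1 := s, n := t)))) l 1 \<and>
          (\<exists>p::int. prime p \<and> real_of_int p > M \<and> \<not> p dvd m \<and>
            p dvd gcd (Ksh n (a(n - 1 := s))) (disc n (a(n - 1 := s, n := t))))}"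
      by (auto simp: G_def K_def D_def)
    also have "T * u * v / (R * (ln R + ln T)) + u * v / (M * ln M) + v + 1
      = (T / (R * (ln R + ln T)) + 1 / (M * ln M) + real_of_int m / A + (real_of_int m) ^ 3 / (A * B))
        * (A * B / (real_of_int m) ^ 3)"
    proof -
      \<comment> \<open>Multiplied by A B / m^3 = u v, the last two terms of the claim become v and
        1.\<close>
      define w where "w = A * B / (real_of_int m) ^ 3"
      have "u * v = w" by (simp add: w_def u_def v_def power2_eq_square power3_eq_cube)
      hence "T * u * v / (R * (ln R + ln T)) = T / (R * (ln R + ln T)) * w" "u * v / (M * ln M) = 1 / (M * ln M) * w"
        by (simp_all add: mult.assoc)
      moreover have "real_of_int m / A * w = v" "(real_of_int m) ^ 3 / (A * B) * w = 1"
        using m A B by (simp_all add: w_def v_def power2_eq_square power3_eq_cube)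
      ultimately show ?thesis unfolding w_def[symmetric] distrib_right by (simp only:)
    qed
    finally show ?thesis by (simp only: mult.assoc)
  qed
  ultimately show ?thesis by (intro exI[of _ C] conjI allI impI)
qed

end
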